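(* Let $A$ be a real symmetric $n\times n$ matrix with zero diagonal, and let $\Delta_A=\operatorname{diag}(A^2)$. Let $F_A(x)=G_A(x)/q_A(x)$ be the matrix-valued rational function defined from the random cut matrices $M_\varepsilon$ (see context). Then $F_A$ has a decomposition $$F_A(x)=\sum_{\lambda:\,q_A(\lambda)=0}\frac{W_\lambda}{x-\lambda}$$ over the distinct roots $\lambda$ of $q_A$, all of which lie in $[-r_A,r_A]$, with every $W_\lambda$ positive semidefinite. With $\mathsf H_m:=\sum_{\lambda:\,q_A(\lambda)=0}\lambda^mW_\lambda$, one has $$\mathsf H_0=I,\qquad \mathsf H_1=\frac A2,\qquad \mathsf H_2=\frac{A^2+\Delta_A}{4}.$$ Consequently, $$A^2+\Delta_A\preceq4r_A^2I,\qquad \mathsf H_{2s}\preceq r_A^2\,\mathsf H_{2s-2}\quad\text{for all integers } s\ge1.$$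
   Context: For a square matrix $B$, $\operatorname{diag}(B)$ denotes the diagonal matrix with the same diagonal as $B$; $\preceq$ is the Loewner (positive semidefinite) order; $\operatorname{adj}$ is the adjugate. For $S\subseteq[n]$, $A[S]$ is the principal submatrix indexed by $S$ (empty determinant equal to $1$). For a real symmetric zero-diagonal $n\times n$ matrix $A$, $$q_A(x)=\chi[A,-A](x)=2^{-n}\sum_{S\subseteq[n]}\det(xI-A[S])\det(xI+A[[n]\setminus S]),$$ which is monic of degree $n$, real-rooted, and satisfies $q_A(-x)=(-1)^nq_A(x)$; $r_A$ is its largest root. Let $\varepsilon_1,\dots,\varepsilon_n$ be independent and uniform on $\{-1,+1\}$, $D_\varepsilon$ the diagonal matrix with diagonal $(\varepsilon_1,\dots,\varepsilon_n)$, and $M_\varepsilon=\tfrac12(A-D_\varepsilon AD_\varepsilon)$. One has $q_A(x)=\mathbb E_\varepsilon\det(xI-M_\varepsilon)$, and one sets $G_A(x)=\mathbb E_\varepsilon\operatorname{adj}(xI-M_\varepsilon)$ and $F_A(x)=G_A(x)/q_A(x)$. *)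

theory Defs
  imports
    "HOL-Probability.Product_PMF"
    "Jordan_Normal_Form.Char_Poly"
    "Jordan_Normal_Form.DL_Submatrix"
begin

definition psd_mat :: "real mat \<Rightarrow> bool" where
  "psd_mat B \<longleftrightarrow> square_mat B \<and> transpose_mat B = B \<and>
     (\<forall>v \<in> carrier_vec (dim_row B). 0 \<le> v \<bullet> (B *\<^sub>v v))"

definition loewner_le :: "real mat \<Rightarrow> real mat \<Rightarrow> bool" (infix \<open>\<preceq>\<^sub>L\<close> 50) where
  "B \<preceq>\<^sub>L C \<longleftrightarrow> dim_row B = dim_row C \<and> dim_col B = dim_col C \<and> psd_mat (C - B)"

definition diag_part :: "real mat \<Rightarrow> real mat" where
  "diag_part B = mat_diag (dim_row B) (\<lambda>i. B $$ (i, i))"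

text \<open>
  The index set \<open>[n]\<close> is \<open>{..<n}\<close> with \<open>n = dim_row A\<close>. Note that
  \<open>char_poly B\<close> is \<open>det (xI - B)\<close>, so \<open>char_poly (- B)\<close> is \<open>det (xI + B)\<close>; for the
  empty index set \<open>submatrix\<close> gives the \<open>0 \<times> 0\<close> matrix, whose determinant is \<open>1\<close>.
\<close>

definition q_poly :: "real mat \<Rightarrow> real poly" where
  "q_poly A = Polynomial.smult (1 / 2 ^ dim_row A)
     (\<Sum>S \<in> Pow {..<dim_row A}.
        char_poly (submatrix A S S) *
        char_poly (- submatrix A ({..<dim_row A} - S) ({..<dim_row A} - S)))"

definition q_roots :: "real mat \<Rightarrow> real set" where
  "q_roots A = {x. poly (q_poly A) x = 0}"

text \<open>For \<open>n = 0\<close> there is no root and \<open>r_max\<close> is an unspecified number.\<close>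

definition r_max :: "real mat \<Rightarrow> real" where
  "r_max A = Max (q_roots A)"

definition sign_pmf :: "nat \<Rightarrow> (nat \<Rightarrow> real) pmf" where
  "sign_pmf n = Pi_pmf {..<n} 0 (\<lambda>_. pmf_of_set {-1, 1})"

definition cut_mat :: "real mat \<Rightarrow> (nat \<Rightarrow> real) \<Rightarrow> real mat" where
  "cut_mat A \<epsilon> =
     (1 / 2) \<cdot>\<^sub>m (A - mat_diag (dim_row A) \<epsilon> * A * mat_diag (dim_row A) \<epsilon>)"

text \<open>The expectation of a random matrix is taken entrywise.\<close>

definition G_mat :: "real mat \<Rightarrow> real \<Rightarrow> real mat" where
  "G_mat A x = mat (dim_row A) (dim_row A) (\<lambda>(i, j).
     measure_pmf.expectation (sign_pmf (dim_row A))
       (\<lambda>\<epsilon>. adj_mat (x \<cdot>\<^sub>m 1\<^sub>m (dim_row A) - cut_mat A \<epsilon>) $$ (i, j)))"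

definition F_mat :: "real mat \<Rightarrow> real \<Rightarrow> real mat" where
  "F_mat A x = (1 / poly (q_poly A) x) \<cdot>\<^sub>m G_mat A x"

text \<open>
  Entrywise sum of \<open>n \<times> n\<close> matrices; the library type of matrices has no
  additive monoid structure that would allow the \<open>\<Sum>\<close> notation.
\<close>

definition mat_sum :: "nat \<Rightarrow> ('a \<Rightarrow> real mat) \<Rightarrow> 'a set \<Rightarrow> real mat" where
  "mat_sum n f S = mat n n (\<lambda>(i, j). \<Sum>a \<in> S. f a $$ (i, j))"

definition H_mat :: "real mat \<Rightarrow> (real \<Rightarrow> real mat) \<Rightarrow> nat \<Rightarrow> real mat" where
  "H_mat A W m = mat_sum (dim_row A) (\<lambda>l. l ^ m \<cdot>\<^sub>m W l) (q_roots A)"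

end

theory Submission
  imports Defs
begin

text \<open>
  Averaging over signs turns cycles of \<open>M\<^sub>\<epsilon>\<close> into cycles living entirely in \<open>S\<close> or in its
  complement: for arbitrary matrices \<open>P\<close> and \<open>Q\<close>, the mean of \<open>det ((P + D\<^sub>\<epsilon> Q D\<^sub>\<epsilon>) / 2)\<close> is
  \<open>2\<^sup>-\<^sup>n\<close> times the sum of \<open>det P[S] det Q[[n] - S]\<close> over all \<open>S\<close>. If \<open>P\<close> and \<open>Q\<close> have positive
  definite imaginary part, this sum does not vanish, by the argument that shows that
  \<open>\<partial>/\<partial>x\<^sub>i + \<partial>/\<partial>y\<^sub>i\<close> preserves stability. Taking \<open>P = zI - A + 2w vv\<^sup>T\<close> and \<open>Q = zI + A\<close> and the rank
  one update formula for determinants gives \<open>q\<^sub>A(z) + w v\<^sup>T G\<^sub>A(z) v \<noteq> 0\<close> for \<open>Im z > 0\<close> and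
  \<open>Im w \<ge> 0\<close>, so that \<open>v\<^sup>T F\<^sub>A v\<close> maps the upper half plane to the closed lower one. Such a
  rational function has only simple real poles, with nonnegative residues. The moments are read off
  from the expansion of the resolvents of \<open>M\<^sub>\<epsilon>\<close> at infinity.
\<close>

subsection \<open>Principal minors\<close>

text \<open>Three obstacles shape the proof. Positivity is known only for the scalar functions
  \<open>v\<^sup>T F v\<close>, while the weights are needed entrywise; divisibility statements are
  additive and therefore pass to the entries by polarization. Next, \<open>q_poly A\<close> may have
  multiple roots that cancel against the numerators, so residues cannot be written with the
  derivative of \<open>q\<close>; simplicity of all poles is instead expressed as \<open>q\<close>
  dividing the numerator times the product of the distinct linear factors of \<open>q\<close>.
  Finally, the characteristic polynomials of the matrices \<open>M\<^sub>\<epsilon>\<close> vary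
  with the signs, so the moments need not be the means of the powers of
  \<open>M\<^sub>\<epsilon>\<close>. The zero diagonal makes all of them agree with \<open>q\<close>
  in degrees \<open>n\<close> and \<open>n - 1\<close>, and their mean is exactly \<open>q\<close>;
  together this keeps the correlation between \<open>M\<^sub>\<epsilon>\<close> and its
  characteristic polynomial out of the moments 0, 1 and 2. Both Loewner bounds then say that a
  combination of the weights with nonnegative coefficients is positive semidefinite.\<close>

definition principal_minor :: "(nat \<Rightarrow> nat \<Rightarrow> 'a) \<Rightarrow> nat set \<Rightarrow> 'a::comm_ring_1" where
  "principal_minor P T = (\<Sum>p | p permutes T. signof p * (\<Prod>i\<in>T. P i (p i)))"

lemma principal_minor_cong:
  assumes "\<And>i j. i \<in> T \<Longrightarrow> j \<in> T \<Longrightarrow> P i j = Q i j"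
  shows "principal_minor P T = principal_minor Q T"
  unfolding principal_minor_def
  by (rule sum.cong[OF refl], rule arg_cong[of _ _ "(*) _"], rule prod.cong[OF refl])
    (simp add: assms permutes_in_image)

lemma det_eq_principal_minor:
  assumes "B \<in> carrier_mat n n"
  shows "Determinant.det B = principal_minor (\<lambda>i j. B $$ (i, j)) {..<n}"
  using assms by (simp add: det_def' principal_minor_def atLeast0LessThan)

lemma principal_minor_eq_det:
  "principal_minor P {..<n} = Determinant.det (mat n n (\<lambda>(i, j). P i j))"
  by (subst det_eq_principal_minor[OF mat_carrier], rule principal_minor_cong) simp

lemma inj_on_pick: "inj_on (pick S) {..<card S}"
  by (intro strict_mono_on_imp_inj_on strict_mono_onI) (simp add: pick_mono_le)

text \<open>\<open>submatrix\<close> renumbers its rows, whereas the sums over \<open>S\<close>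
  below need minors indexed by \<open>S\<close> itself. Conjugation with the enumeration
  \<open>pick S\<close> is a sign-preserving bijection between the permutations of
  \<open>{..<card S}\<close> and those of \<open>S\<close>.\<close>

lemma det_submatrix:
  assumes B: "B \<in> carrier_mat n n" and S: "S \<subseteq> {..<n}"
  shows "Determinant.det (submatrix B S S) = principal_minor (\<lambda>i j. B $$ (i, j)) S"
proof -
  have fin: "finite S" using S finite_subset by blast
  have S_eq: "{i. i < n \<and> i \<in> S} = S" using S by auto
  let ?k = "card S"
  have carr: "submatrix B S S \<in> carrier_mat ?k ?k"
    by (rule carrier_matI) (simp_all only: dim_submatrix carrier_matD[OF B] S_eq)
  have entry: "submatrix B S S $$ (i, j) = B $$ (pick S i, pick S j)" if "i < ?k" "j < ?k" for i j
    using that B by (subst submatrix_index) (auto simp: S_eq)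
  have bij: "bij_betw (pick S) {..<?k} S"
  proof (rule bij_betwI')
    show "(pick S x = pick S y) = (x = y)" if "x \<in> {..<?k}" "y \<in> {..<?k}" for x y
      using inj_on_pick[of S] that by (auto dest: inj_onD)
    show "pick S x \<in> S" if "x \<in> {..<?k}" for x
      using that by (simp add: pick_in_set_le)
    show "\<exists>x\<in>{..<?k}. y = pick S x" if "y \<in> S" for y
    proof
      show "y = pick S (card {a\<in>S. a < y})" using pick_card_in_set[OF that] by simp
      have "{a\<in>S. a < y} \<subset> S" using that by auto
      then show "card {a\<in>S. a < y} \<in> {..<?k}" using fin by (simp add: psubset_card_mono)
    qed
  qed
  let ?c = "\<lambda>p x. if x \<in> S then pick S (p (inv_into {..<?k} (pick S) x)) else x"
  have inj: "inj_on (pick S) {..<?k}" and img: "pick S ` {..<?k} = S"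
    using bij by (auto simp: bij_betw_def)
  have c_eq: "?c p = map_permutation {..<?k} (pick S) p" for p
    by (rule ext) (simp add: map_permutation_def restrict_id_def img)
  have "principal_minor (\<lambda>i j. B $$ (i, j)) S
      = (\<Sum>p | p permutes {..<?k}. signof (?c p) * (\<Prod>i\<in>S. B $$ (i, ?c p i)))"
    unfolding principal_minor_def
    by (rule sum.reindex_bij_betw[OF bij_betw_permutations[OF bij], symmetric])
  also have "\<dots> = principal_minor (\<lambda>i j. submatrix B S S $$ (i, j)) {..<?k}"
    unfolding principal_minor_def
  proof (rule sum.cong[OF refl])
    fix p assume "p \<in> {p. p permutes {..<?k}}"
    then have p: "p permutes {..<?k}" by simp
    have sg: "sign (?c p) = sign p"
      unfolding c_eq by (rule sign_map_permutation[OF inj p]) simp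
    have "(\<Prod>i\<in>S. B $$ (i, ?c p i)) = (\<Prod>j<?k. B $$ (pick S j, ?c p (pick S j)))"
      by (rule prod.reindex_bij_betw[OF bij, symmetric])
    also have "\<dots> = (\<Prod>j<?k. submatrix B S S $$ (j, p j))"
    proof (rule prod.cong[OF refl])
      fix j assume j: "j \<in> {..<?k}"
      have "p j < ?k" using permutes_in_image[OF p, of j] j by simp
      moreover have "pick S j \<in> S" using img j by blast
      ultimately show "B $$ (pick S j, ?c p (pick S j)) = submatrix B S S $$ (j, p j)"
        using j inj by (simp add: entry)
    qed
    finally show "signof (?c p) * (\<Prod>i\<in>S. B $$ (i, ?c p i))
        = signof p * (\<Prod>j<?k. submatrix B S S $$ (j, p j))"
      by (simp only: sg)
  qed
  finally show ?thesis
    using det_eq_principal_minor[OF carr] by simp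
qed

subsection \<open>Averages over random signs\<close>

text \<open>The support of \<open>sign_pmf n\<close>, with the default value \<open>0\<close> of
  \<open>Pi_pmf\<close> outside \<open>{..<n}\<close>; expectations become finite sums over it,
  divided by \<open>2 ^ n\<close>.\<close>

definition signs :: "nat \<Rightarrow> (nat \<Rightarrow> real) set" where
  "signs n = PiE_dflt {..<n} 0 (\<lambda>_. {-1, 1})"

lemma finite_signs [simp]: "finite (signs n)"
  unfolding signs_def by (rule finite_PiE_dflt) auto

lemma card_signs [simp]: "card (signs n) = 2 ^ n"
  unfolding signs_def by (subst card_PiE_dflt) (simp_all add: numeral_2_eq_2)

lemma signs_nonempty [simp]: "signs n \<noteq> {}"
  using card_signs[of n] by (metis card.empty power_not_zero zero_neq_numeral)

lemma signs_square: "\<epsilon> \<in> signs n \<Longrightarrow> i < n \<Longrightarrow> \<epsilon> i * \<epsilon> i = 1"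
  by (auto simp: signs_def PiE_dflt_def)

lemma expectation_sign_pmf:
  fixes f :: "_ \<Rightarrow> real"
  shows "measure_pmf.expectation (sign_pmf n) f = (\<Sum>\<epsilon>\<in>signs n. f \<epsilon>) / 2 ^ n"
proof -
  have "sign_pmf n = pmf_of_set (signs n)"
    unfolding sign_pmf_def signs_def by (rule Pi_pmf_of_set) auto
  then show ?thesis by (simp add: integral_pmf_of_set)
qed

lemma sum_signs_prod:
  fixes f :: "nat \<Rightarrow> real \<Rightarrow> 'a::comm_ring_1"
  shows "(\<Sum>\<epsilon>\<in>signs n. \<Prod>i<n. f i (\<epsilon> i)) = (\<Prod>i<n. f i (-1) + f i 1)"
proof -
  \<comment> \<open>Functions in \<open>PiE\<close> are \<open>undefined\<close> outside the index
    set, those in \<open>signs n\<close> are \<open>0\<close> there; \<open>?h\<close> translates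
    between the two.\<close>
  let ?h = "\<lambda>h x. if x \<in> {..<n} then h x else (0::real)"
  have inj: "inj_on ?h (PiE {..<n} (\<lambda>_. {-1, 1}))"
  proof (rule inj_onI)
    fix g h :: "nat \<Rightarrow> real"
    assume gh: "g \<in> PiE {..<n} (\<lambda>_. {-1, 1})" "h \<in> PiE {..<n} (\<lambda>_. {-1, 1})" and eq: "?h g = ?h h"
    show "g = h"
    proof (rule PiE_ext[OF gh])
      show "g x = h x" if "x \<in> {..<n}" for x using fun_cong[OF eq, of x] that by simp
    qed
  qed
  have "(\<Sum>\<epsilon>\<in>signs n. \<Prod>i<n. f i (\<epsilon> i)) = (\<Sum>h\<in>PiE {..<n} (\<lambda>_. {-1, 1}). \<Prod>i<n. f i (?h h i))"
    unfolding signs_def by (subst dflt_image_PiE[symmetric], subst sum.reindex[OF inj]) (simp add: o_def)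
  also have "\<dots> = (\<Sum>h\<in>PiE {..<n} (\<lambda>_. {-1, 1}). \<Prod>i<n. f i (h i))" by simp
  also have "\<dots> = (\<Prod>i<n. \<Sum>e\<in>{-1,1}. f i e)" by (rule prod_sum_PiE[symmetric]) auto
  finally show ?thesis by simp
qed

text \<open>Orthogonality of the characters of the sign group: an index in exactly one of
  \<open>U\<close> and \<open>V\<close> contributes the factor -1 + 1 = 0, every other index the
  factor 2.\<close>

lemma sum_signs_prod_prod:
  assumes U: "U \<subseteq> {..<n}" and V: "V \<subseteq> {..<n}"
  shows "(\<Sum>\<epsilon>\<in>signs n. prod \<epsilon> U * prod \<epsilon> V) = (if U = V then 2 ^ n else 0)"
proof -
  let ?f = "\<lambda>i e::real. (if i \<in> U then e else 1) * (if i \<in> V then e else 1)"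
  have ex: "prod \<epsilon> U = (\<Prod>i<n. if i \<in> U then \<epsilon> i else 1)" if "U \<subseteq> {..<n}" for U and \<epsilon> :: "nat \<Rightarrow> real"
    by (subst prod.inter_restrict[symmetric]) (use that in \<open>simp_all add: Int_absorb1\<close>)
  have "(\<Sum>\<epsilon>\<in>signs n. prod \<epsilon> U * prod \<epsilon> V) = (\<Sum>\<epsilon>\<in>signs n. \<Prod>i<n. ?f i (\<epsilon> i))"
    unfolding ex[OF U] ex[OF V] prod.distrib[symmetric] ..
  also have "\<dots> = (\<Prod>i<n. ?f i (-1) + ?f i 1)" by (rule sum_signs_prod)
  also have "\<dots> = (if U = V then 2 ^ n else 0)"
  proof (cases "U = V")
    case True
    have "(\<Prod>i<n. ?f i (-1) + ?f i 1) = (\<Prod>i<n. 2)" by (rule prod.cong) (auto simp: True)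
    then show ?thesis by (simp add: True)
  next
    case False
    then obtain i where "i < n" "(i \<in> U) \<noteq> (i \<in> V)" using U V by blast
    then have "\<exists>i\<in>{..<n}. ?f i (-1) + ?f i 1 = 0" by (intro bexI[of _ i]) auto
    then show ?thesis by (simp add: False prod_zero)
  qed
  finally show ?thesis .
qed

text \<open>A permutation that maps \<open>S\<close> onto itself is the composition of a permutation
  of \<open>S\<close> and one of \<open>N - S\<close>, and the sign is multiplicative.\<close>

lemma sum_permutes_preserving:
  assumes fin: "finite N" and S: "S \<subseteq> N"
  shows "(\<Sum>p | p permutes N \<and> p ` S = S. signof p * ((\<Prod>i\<in>S. P i (p i)) * (\<Prod>i\<in>N - S. Q i (p i))))
    = principal_minor P S * principal_minor Q (N - S)"
proof -
  let ?g = "\<lambda>p. signof p * ((\<Prod>i\<in>S. P i (p i)) * (\<Prod>i\<in>N - S. Q i (p i)))"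
  let ?X = "{p. p permutes S}" and ?Y = "{p. p permutes (N - S)}"
  have finS: "finite S" "finite (N - S)" using fin S finite_subset by auto
  have pX: "p x \<in> S \<longleftrightarrow> x \<in> S" if "p ` S = S" "p permutes N" for p x
    using that by (metis image_eqI permutes_inj inj_image_mem_iff)
  have "principal_minor P S * principal_minor Q (N - S) =
     (\<Sum>(a, b)\<in>?X \<times> ?Y. (signof a * (\<Prod>i\<in>S. P i (a i))) * (signof b * (\<Prod>i\<in>N - S. Q i (b i))))"
    unfolding principal_minor_def sum_product sum.cartesian_product ..
  also have "\<dots> = (\<Sum>p | p permutes N \<and> p ` S = S. ?g p)"
  proof (rule sum.reindex_bij_witness[where
        i = "\<lambda>p. (\<lambda>x. if x \<in> S then p x else x, \<lambda>x. if x \<in> N - S then p x else x)" and j = "\<lambda>(a, b). a \<circ> b"], goal_cases)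
    case (1 z)
    obtain a b where z: "z = (a, b)" and a: "a permutes S" and b: "b permutes (N - S)" using 1 by auto
    have "a (b x) = a x" if "x \<in> S" for x using b that by (simp add: permutes_not_in)
    moreover have "a (b x) = b x" if "x \<in> N - S" for x
      using a b that permutes_in_image[OF b, of x] by (simp add: permutes_not_in)
    ultimately show ?case
      using z a b by (auto simp: fun_eq_iff permutes_not_in)
  next
    case (2 z)
    obtain a b where z: "z = (a, b)" and a: "a permutes S" and b: "b permutes (N - S)" using 2 by auto
    have aN: "a permutes N" and bN: "b permutes N" using a b S permutes_subset by (blast+)
    have "(a \<circ> b) ` S = S"
    proof -
      have "b ` S = S" using b by (force simp: permutes_not_in)
      then show ?thesis unfolding image_comp[symmetric] by (simp add: permutes_image[OF a])
    qed
    then show ?case using z permutes_compose[OF bN aN] by simp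
  next
    case (3 p)
    then have p: "p permutes N" and pS: "p ` S = S" by auto
    show ?case using p permutes_not_in[OF p] pX[OF pS p] by (auto simp: fun_eq_iff)
  next
    case (4 p)
    then have p: "p permutes N" and pS: "p ` S = S" by auto
    have inj: "inj p" using p by (rule permutes_inj)
    have pN: "p ` (N - S) = N - S"
      using permutes_image[OF p] pS inj by (metis image_set_diff)
    have "(\<lambda>x. if x \<in> S then p x else x) permutes S"
      by (rule bij_imp_permutes) (auto simp: bij_betw_def pS intro!: inj_onI dest: injD[OF inj] cong: image_cong)
    moreover have "(\<lambda>x. if x \<in> N - S then p x else x) permutes (N - S)"
    proof (rule bij_imp_permutes)
      show "bij_betw (\<lambda>x. if x \<in> N - S then p x else x) (N - S) (N - S)"
        using pN inj by (subst bij_betw_cong[of _ _ p]) (auto simp: bij_betw_def intro: inj_on_subset)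
    qed auto
    ultimately show ?case by simp
  next
    case (5 z)
    obtain a b where z: "z = (a, b)" and a: "a permutes S" and b: "b permutes (N - S)" using 5 by auto
    have aN: "permutation a" and bN: "permutation b"
      using a b finS by (auto simp: permutation_permutes)
    have "a (b x) = a x" if "x \<in> S" for x using b that by (simp add: permutes_not_in)
    moreover have "a (b x) = b x" if "x \<in> N - S" for x
      using a b that permutes_in_image[OF b, of x] by (simp add: permutes_not_in)
    ultimately have "(\<Prod>i\<in>S. P i ((a \<circ> b) i)) = (\<Prod>i\<in>S. P i (a i))"
      and "(\<Prod>i\<in>N - S. Q i ((a \<circ> b) i)) = (\<Prod>i\<in>N - S. Q i (b i))"
      by (auto intro!: prod.cong)
    then show ?case by (simp only: z prod.case sign_compose[OF aN bN] of_int_mult mult_ac)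
  qed
  finally show ?thesis ..
qed

text \<open>For a fixed permutation \<open>p\<close>, expanding the product takes \<open>P\<close>
  in the rows of a set \<open>S\<close> and \<open>Q\<close> in the others. The signs collect to the
  product over \<open>{..<n} - S\<close> times the product over its image under \<open>p\<close>; by
  orthogonality this averages to 1 if \<open>p\<close> preserves \<open>S\<close> and to 0
  otherwise. The \<open>n\<close> factors 1/2 cancel against the \<open>2 ^ n\<close> sign vectors,
  so the right-hand side carries no constant.\<close>

lemma sum_signs_principal_minor:
  fixes P Q :: "nat \<Rightarrow> nat \<Rightarrow> 'a::real_field"
  shows "(\<Sum>\<epsilon>\<in>signs n. principal_minor (\<lambda>i j. (P i j + of_real (\<epsilon> i * \<epsilon> j) * Q i j) / 2) {..<n})
    = (\<Sum>S\<in>Pow {..<n}. principal_minor P S * principal_minor Q ({..<n} - S))"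
proof -
  let ?N = "{..<n}"
  let ?m = "\<lambda>p S. (\<Prod>i\<in>S. P i (p i)) * (\<Prod>i\<in>?N - S. Q i (p i))"
  have perm: "(\<Sum>\<epsilon>\<in>signs n. \<Prod>i<n. (P i (p i) + of_real (\<epsilon> i * \<epsilon> (p i)) * Q i (p i)) / 2)
      = (\<Sum>S\<in>Pow ?N. if p ` S = S then ?m p S else 0)" if p: "p permutes ?N" for p
  proof -
    have inj: "inj p" using p by (rule permutes_inj)
    have "(\<Prod>i<n. (P i (p i) + of_real (\<epsilon> i * \<epsilon> (p i)) * Q i (p i)) / 2)
      = (\<Sum>S\<in>Pow ?N. ?m p S / 2 ^ n * of_real (prod \<epsilon> (?N - S) * prod \<epsilon> (p ` (?N - S))))" for \<epsilon>
    proof -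
      have "(\<Prod>i<n. (P i (p i) + of_real (\<epsilon> i * \<epsilon> (p i)) * Q i (p i)) / 2)
        = (\<Prod>i<n. P i (p i) + of_real (\<epsilon> i * \<epsilon> (p i)) * Q i (p i)) / 2 ^ n"
        by (simp add: prod_dividef)
      also have "\<dots> = (\<Sum>S\<in>Pow ?N. (\<Prod>i\<in>S. P i (p i)) * (\<Prod>i\<in>?N-S. of_real (\<epsilon> i * \<epsilon> (p i)) * Q i (p i))) / 2 ^ n"
        by (subst prod_add) auto
      also have "\<dots> = (\<Sum>S\<in>Pow ?N. ?m p S / 2 ^ n * of_real (prod \<epsilon> (?N - S) * prod \<epsilon> (p ` (?N - S))))"
        unfolding sum_divide_distrib
      proof (rule sum.cong[OF refl])
        fix S
        have e1: "prod \<epsilon> (p ` (?N - S)) = (\<Prod>i\<in>?N - S. \<epsilon> (p i))"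
          by (subst prod.reindex) (simp_all add: inj_on_subset[OF inj] o_def)
        have e2: "(\<Prod>i\<in>?N-S. of_real (\<epsilon> i * \<epsilon> (p i)) * Q i (p i))
          = of_real (prod \<epsilon> (?N - S) * (\<Prod>i\<in>?N - S. \<epsilon> (p i))) * (\<Prod>i\<in>?N - S. Q i (p i))"
          by (simp only: prod.distrib of_real_prod of_real_mult)
        have e3: "x * (y * z) / w = x * z / w * y" for x y z w :: 'a by simp
        show "(\<Prod>i\<in>S. P i (p i)) * (\<Prod>i\<in>?N-S. of_real (\<epsilon> i * \<epsilon> (p i)) * Q i (p i)) / 2 ^ n
          = ?m p S / 2 ^ n * of_real (prod \<epsilon> (?N - S) * prod \<epsilon> (p ` (?N - S)))"
          unfolding e1 e2 by (rule e3)
      qed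
      finally show ?thesis .
    qed
    then have "(\<Sum>\<epsilon>\<in>signs n. \<Prod>i<n. (P i (p i) + of_real (\<epsilon> i * \<epsilon> (p i)) * Q i (p i)) / 2)
      = (\<Sum>\<epsilon>\<in>signs n. \<Sum>S\<in>Pow ?N. ?m p S / 2 ^ n * of_real (prod \<epsilon> (?N - S) * prod \<epsilon> (p ` (?N - S))))"
      by simp
    also have "\<dots> = (\<Sum>S\<in>Pow ?N. ?m p S / 2 ^ n * of_real (\<Sum>\<epsilon>\<in>signs n. prod \<epsilon> (?N - S) * prod \<epsilon> (p ` (?N - S))))"
      unfolding of_real_sum sum_distrib_left by (rule sum.swap)
    also have "\<dots> = (\<Sum>S\<in>Pow ?N. if p ` S = S then ?m p S else 0)"
    proof (rule sum.cong[OF refl])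
      fix S assume S: "S \<in> Pow ?N"
      have sub: "p ` (?N - S) \<subseteq> ?N" using permutes_image[OF p] by blast
      have pD: "p ` (?N - S) = ?N - p ` S"
        using permutes_image[OF p] inj by (metis image_set_diff)
      have "p ` S \<subseteq> ?N" using S permutes_image[OF p] by blast
      moreover have "?N - S = ?N - T \<longleftrightarrow> T = S" if "T \<subseteq> ?N" for T using that S by blast
      ultimately have iff: "?N - S = p ` (?N - S) \<longleftrightarrow> p ` S = S" unfolding pD by simp
      show "?m p S / 2 ^ n * of_real (\<Sum>\<epsilon>\<in>signs n. prod \<epsilon> (?N - S) * prod \<epsilon> (p ` (?N - S)))
        = (if p ` S = S then ?m p S else 0)"
        by (subst sum_signs_prod_prod[OF _ sub]) (auto simp: iff)
    qed
    finally show ?thesis .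
  qed
  have "(\<Sum>\<epsilon>\<in>signs n. principal_minor (\<lambda>i j. (P i j + of_real (\<epsilon> i * \<epsilon> j) * Q i j) / 2) ?N)
    = (\<Sum>p | p permutes ?N. signof p * (\<Sum>\<epsilon>\<in>signs n. \<Prod>i<n. (P i (p i) + of_real (\<epsilon> i * \<epsilon> (p i)) * Q i (p i)) / 2))"
    unfolding principal_minor_def sum_distrib_left by (rule sum.swap)
  also have "\<dots> = (\<Sum>p | p permutes ?N. \<Sum>S\<in>Pow ?N. if p ` S = S then signof p * ?m p S else 0)"
    by (rule sum.cong[OF refl], subst perm) (auto simp: sum_distrib_left intro!: sum.cong)
  also have "\<dots> = (\<Sum>S\<in>Pow ?N. \<Sum>p | p permutes ?N. if p ` S = S then signof p * ?m p S else 0)"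
    by (rule sum.swap)
  also have "\<dots> = (\<Sum>S\<in>Pow ?N. principal_minor P S * principal_minor Q (?N - S))"
  proof (rule sum.cong[OF refl])
    fix S assume "S \<in> Pow ?N"
    then have "S \<subseteq> ?N" by simp
    have "(\<Sum>p | p permutes ?N. if p ` S = S then signof p * ?m p S else 0)
      = (\<Sum>p\<in>{p \<in> {p. p permutes ?N}. p ` S = S}. signof p * ?m p S)"
      by (rule sum.inter_filter[symmetric]) (simp add: finite_permutations)
    then show "(\<Sum>p | p permutes ?N. if p ` S = S then signof p * ?m p S else 0)
      = principal_minor P S * principal_minor Q (?N - S)"
      using sum_permutes_preserving[OF _ \<open>S \<subseteq> ?N\<close>, of P Q] by simp
  qed
  finally show ?thesis .
qed

subsection \<open>Dissipative matrices\<close>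

text \<open>In matrix terms, with \<open>P^H\<close> the conjugate transpose, the Hermitian matrix
  \<open>(P - P^H) / 2i\<close> is positive definite on \<open>T\<close>. The form on functions
  passes to subsets of \<open>T\<close> without renumbering.\<close>

definition dissipative :: "(nat \<Rightarrow> nat \<Rightarrow> complex) \<Rightarrow> nat set \<Rightarrow> bool" where
  "dissipative P T \<longleftrightarrow> (\<forall>v. (\<exists>i\<in>T. v i \<noteq> 0) \<longrightarrow>
     0 < Im (\<Sum>i\<in>T. \<Sum>j\<in>T. cnj (v i) * P i j * v j))"

lemma dissipative_subset:
  assumes "dissipative P T" "finite T" "T' \<subseteq> T"
  shows "dissipative P T'"
  unfolding dissipative_def
proof (intro allI impI)
  fix v :: "nat \<Rightarrow> complex" assume v: "\<exists>i\<in>T'. v i \<noteq> 0"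
  let ?w = "\<lambda>i. if i \<in> T' then v i else 0"
  have "0 < Im (\<Sum>i\<in>T. \<Sum>j\<in>T. cnj (?w i) * P i j * ?w j)"
    using assms(1)[unfolded dissipative_def, rule_format, of ?w] v assms(3) by fastforce
  also have "(\<Sum>i\<in>T. \<Sum>j\<in>T. cnj (?w i) * P i j * ?w j) = (\<Sum>i\<in>T'. \<Sum>j\<in>T'. cnj (?w i) * P i j * ?w j)"
    using assms(2,3) by (intro sum.mono_neutral_cong_right ballI sum.neutral) auto
  also have "\<dots> = (\<Sum>i\<in>T'. \<Sum>j\<in>T'. cnj (v i) * P i j * v j)" by simp
  finally show "0 < Im (\<Sum>i\<in>T'. \<Sum>j\<in>T'. cnj (v i) * P i j * v j)" .
qed

lemma dissipative_add_diag:
  assumes "dissipative P T" "finite T" "0 \<le> Im x"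
  shows "dissipative (\<lambda>k l. P k l + (if k = i \<and> l = i then x else 0)) T"
  unfolding dissipative_def
proof (intro allI impI)
  fix v :: "nat \<Rightarrow> complex" assume v: "\<exists>i\<in>T. v i \<noteq> 0"
  have "(\<Sum>k\<in>T. \<Sum>l\<in>T. cnj (v k) * (if k = i \<and> l = i then x else 0) * v l)
     = (\<Sum>k\<in>T. if k = i then (\<Sum>l\<in>T. if l = i then cnj (v i) * x * v i else 0) else 0)"
    by (auto intro!: sum.cong)
  also have "\<dots> = (if i \<in> T then of_real ((cmod (v i))\<^sup>2) * x else 0)"
  proof -
    have "cnj (v i) * x * v i = of_real ((cmod (v i))\<^sup>2) * x"
      by (subst complex_norm_square) (simp add: mult_ac)
    then show ?thesis using \<open>finite T\<close> by (simp del: of_real_power)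
  qed
  finally have "0 \<le> Im (\<Sum>k\<in>T. \<Sum>l\<in>T. cnj (v k) * (if k = i \<and> l = i then x else 0) * v l)"
    using assms(3) by (simp del: of_real_power)
  moreover have "0 < Im (\<Sum>i\<in>T. \<Sum>j\<in>T. cnj (v i) * P i j * v j)"
    using assms(1) v by (simp add: dissipative_def)
  ultimately show "0 < Im (\<Sum>k\<in>T. \<Sum>l\<in>T. cnj (v k) * (P k l + (if k = i \<and> l = i then x else 0)) * v l)"
    by (simp only: distrib_left distrib_right sum.distrib plus_complex.simps add_pos_nonneg)
qed

text \<open>With the identity outside \<open>T\<close>, only permutations that fix every point
  outside \<open>T\<close> survive. This makes the minor a determinant, so that its vanishing yields
  a kernel vector.\<close>

lemma principal_minor_eq_det_pad:
  assumes T: "T \<subseteq> {..<n}"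
  shows "principal_minor P T =
    Determinant.det (mat n n (\<lambda>(i, j). if i \<in> T \<and> j \<in> T then P i j else if i = j then 1 else 0))"
proof -
  let ?R = "\<lambda>i j. if i \<in> T \<and> j \<in> T then P i j else if i = j then 1 else 0"
  have "principal_minor ?R {..<n} = (\<Sum>p | p permutes T. signof p * (\<Prod>i<n. ?R i (p i)))"
    unfolding principal_minor_def
  proof (rule sum.mono_neutral_right)
    show "{p. p permutes T} \<subseteq> {p. p permutes {..<n}}" using permutes_subset T by blast
    show "\<forall>p\<in>{p. p permutes {..<n}} - {p. p permutes T}. signof p * (\<Prod>i<n. ?R i (p i)) = 0"
    proof
      fix p assume p: "p \<in> {p. p permutes {..<n}} - {p. p permutes T}"
      then obtain i where i: "i \<in> {..<n} - T" "p i \<noteq> i" using permutes_superset[of p "{..<n}" T] by blast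
      then have "?R i (p i) = 0" by auto
      then have "(\<Prod>i<n. ?R i (p i)) = 0" using i by (intro prod_zero) auto
      then show "signof p * (\<Prod>i<n. ?R i (p i)) = 0" by simp
    qed
  qed (simp add: finite_permutations)
  also have "\<dots> = principal_minor P T"
    unfolding principal_minor_def
  proof (rule sum.cong[OF refl])
    fix p assume "p \<in> {p. p permutes T}"
    then have p: "p permutes T" by simp
    have "(\<Prod>i<n. ?R i (p i)) = (\<Prod>i\<in>T. P i (p i))"
      by (rule prod.mono_neutral_cong_right) (use T p in \<open>auto simp: permutes_in_image permutes_not_in\<close>)
    then show "signof p * (\<Prod>i<n. ?R i (p i)) = signof p * (\<Prod>i\<in>T. P i (p i))" by simp
  qed
  finally show ?thesis using principal_minor_eq_det[of ?R n] by simp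
qed

text \<open>A kernel vector of the padded matrix vanishes outside \<open>T\<close>, so its quadratic
  form over \<open>T\<close> would be 0 instead of having positive imaginary part.\<close>

lemma dissipative_principal_minor_nonzero:
  assumes diss: "dissipative P T" and fin: "finite T"
  shows "principal_minor P T \<noteq> 0"
proof
  assume 0: "principal_minor P T = 0"
  obtain n where T: "T \<subseteq> {..<n}" using fin finite_nat_iff_bounded by blast
  let ?M = "mat n n (\<lambda>(i, j). if i \<in> T \<and> j \<in> T then P i j else if i = j then 1 else 0)"
  have "Determinant.det ?M = 0" using 0 unfolding principal_minor_eq_det_pad[OF T] .
  then obtain v where v: "v \<in> carrier_vec n" "v \<noteq> 0\<^sub>v n" "?M *\<^sub>v v = 0\<^sub>v n"
    using det_0_iff_vec_prod_zero[of ?M n] by auto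
  have row: "(\<Sum>j<n. (if i \<in> T \<and> j \<in> T then P i j else if i = j then 1 else 0) * v $ j) = 0" if "i < n" for i
    using that arg_cong[OF v(3), of "\<lambda>w. w $ i"] v(1)
    by (simp add: scalar_prod_def atLeast0LessThan)
  have out: "v $ i = 0" if "i < n" "i \<notin> T" for i
    using row[OF that(1)] that by (simp add: if_distrib[of "\<lambda>a. a * _"] cong: if_cong)
  have ker: "(\<Sum>j\<in>T. P i j * v $ j) = 0" if "i \<in> T" for i
  proof -
    have "(\<Sum>j<n. (if i \<in> T \<and> j \<in> T then P i j else if i = j then 1 else 0) * v $ j) = (\<Sum>j\<in>T. P i j * v $ j)"
      by (rule sum.mono_neutral_cong_right) (use T that out in auto)
    then show ?thesis using row[of i] T that by auto
  qed
  obtain i where "i < n" "v $ i \<noteq> 0" using v(1,2) by (metis carrier_vecD eq_vecI index_zero_vec)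
  then have "\<exists>i\<in>T. v $ i \<noteq> 0" using out by blast
  then have "0 < Im (\<Sum>i\<in>T. \<Sum>j\<in>T. cnj (v $ i) * P i j * v $ j)"
    using diss unfolding dissipative_def by simp
  also have "(\<Sum>i\<in>T. \<Sum>j\<in>T. cnj (v $ i) * P i j * v $ j) = (\<Sum>i\<in>T. cnj (v $ i) * (\<Sum>j\<in>T. P i j * v $ j))"
    by (simp only: sum_distrib_left mult.assoc)
  also have "\<dots> = 0" using ker by simp
  finally show False by simp
qed

text \<open>The entry at \<open>(i, i)\<close> is used exactly by the permutations that fix
  \<open>i\<close>, which are the permutations of \<open>T\<close>. Hence the minor is affine in
  \<open>x\<close>, and its slope is the minor with \<open>i\<close> deleted.\<close>

lemma principal_minor_add_diag:
  assumes "finite T" "i \<notin> T"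
  shows "principal_minor (\<lambda>k l. P k l + (if k = i \<and> l = i then x else 0)) (insert i T)
    = principal_minor P (insert i T) + x * principal_minor P T"
proof -
  let ?A = "{p. p permutes insert i T}"
  have fin: "finite ?A" using assms by (simp add: finite_permutations)
  have prodT: "(\<Prod>k\<in>T. P k (p k) + (if k = i \<and> p k = i then x else 0)) = (\<Prod>k\<in>T. P k (p k))" for p
    using assms by (intro prod.cong) auto
  have "principal_minor (\<lambda>k l. P k l + (if k = i \<and> l = i then x else 0)) (insert i T)
    = (\<Sum>p\<in>?A. signof p * (\<Prod>k\<in>insert i T. P k (p k)) + (if p i = i then x * (signof p * (\<Prod>k\<in>T. P k (p k))) else 0))"
    unfolding principal_minor_def by (rule sum.cong) (simp_all add: assms prodT algebra_simps)
  also have "\<dots> = principal_minor P (insert i T) + (\<Sum>p\<in>?A. if p i = i then x * (signof p * (\<Prod>k\<in>T. P k (p k))) else 0)"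
    unfolding sum.distrib principal_minor_def ..
  also have "(\<Sum>p\<in>?A. if p i = i then x * (signof p * (\<Prod>k\<in>T. P k (p k))) else 0)
    = (\<Sum>p\<in>{p \<in> ?A. p i = i}. x * (signof p * (\<Prod>k\<in>T. P k (p k))))"
    by (rule sum.inter_filter[symmetric, OF fin])
  also have "{p \<in> ?A. p i = i} = {p. p permutes T}"
    using assms permutes_superset[of _ "insert i T" T] permutes_subset[of _ T "insert i T"]
    by (auto simp: permutes_not_in)
  finally show ?thesis by (simp add: principal_minor_def sum_distrib_left)
qed

lemma sum_Pow_insert:
  assumes "finite U" "i \<notin> U"
  shows "(\<Sum>S\<in>Pow (insert i U). f S) = (\<Sum>S\<in>Pow U. f S + f (insert i S))"
proof -
  have "inj_on (insert i) (Pow U)" using assms(2) by (intro inj_onI) (auto simp: insert_ident)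
  then show ?thesis unfolding Pow_insert using assms
    by (subst sum.union_disjoint) (auto simp: sum.reindex sum.distrib)
qed

text \<open>For \<open>c = 0\<close> the two roots are opposite to each other, and one of them lies
  in the closed upper half plane.\<close>

lemma linear_coeff_nonzero:
  fixes a c d :: complex
  assumes "\<And>s. 0 \<le> Im s \<Longrightarrow> a + c * s + d * s\<^sup>2 \<noteq> 0" "d \<noteq> 0"
  shows "c \<noteq> 0"
proof
  assume c: "c = 0"
  define s where "s = csqrt (- a / d)"
  have s: "a + d * s\<^sup>2 = 0" using assms(2) by (simp add: s_def)
  show False
  proof (cases "0 \<le> Im s")
    case True then show False using assms(1)[of s] s c by simp
  next
    case False then show False using assms(1)[of "- s"] s c by simp
  qed
qed

text \<open>Only \<open>V = {}\<close> is wanted; the indices in \<open>V\<close>, shared by both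
  minors, carry the induction. When \<open>i\<close> is moved into \<open>V\<close> and the same
  \<open>s\<close> is added to both entries at \<open>(i, i)\<close>, the sum becomes a quadratic
  polynomial in \<open>s\<close>. Its linear coefficient deletes \<open>i\<close> from exactly one
  of the two minors, and this is the sum for \<open>insert i U\<close>.\<close>

lemma sum_principal_minor_products_nonzero:
  assumes "finite U" "finite V" "U \<inter> V = {}" "dissipative P (U \<union> V)" "dissipative Q (U \<union> V)"
  shows "(\<Sum>S\<in>Pow U. principal_minor P (S \<union> V) * principal_minor Q ((U - S) \<union> V)) \<noteq> 0"
  using assms
proof (induction U arbitrary: V P Q rule: finite_induct)
  case empty
  then show ?case by (simp add: dissipative_principal_minor_nonzero)
next
  case (insert i U)
  have disj: "U \<inter> V = {}" "i \<notin> V" and finUV: "finite (U \<union> V)" using insert by auto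
  let ?P = "\<lambda>s k l. P k l + (if k = i \<and> l = i then s else 0)"
  let ?Q = "\<lambda>s k l. Q k l + (if k = i \<and> l = i then s else 0)"
  let ?p = "\<lambda>S. principal_minor P (S \<union> V)" and ?p' = "\<lambda>S. principal_minor P (insert i (S \<union> V))"
  let ?q = "\<lambda>S. principal_minor Q ((U - S) \<union> V)" and ?q' = "\<lambda>S. principal_minor Q (insert i ((U - S) \<union> V))"
  \<comment> \<open>In \<open>a\<close>, \<open>c\<close>, \<open>d\<close> the index
    \<open>i\<close> is kept in both minors, deleted from exactly one, deleted from both. The
    induction hypothesis at \<open>V\<close> gives \<open>d \<noteq> 0\<close>; at
    \<open>insert i V\<close>, with shifted diagonal entries, it excludes zeros of the quadratic for
    \<open>0 \<le> Im s\<close>.\<close>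
  define a where "a = (\<Sum>S\<in>Pow U. ?p' S * ?q' S)"
  define c where "c = (\<Sum>S\<in>Pow U. ?p S * ?q' S + ?p' S * ?q S)"
  define d where "d = (\<Sum>S\<in>Pow U. ?p S * ?q S)"
  have diss: "dissipative P (U \<union> V)" "dissipative Q (U \<union> V)"
    using insert.prems insert.hyps by (auto intro: dissipative_subset[where T = "insert i U \<union> V"])
  have d: "d \<noteq> 0" unfolding d_def by (rule insert.IH) (use insert.prems disj diss in auto)
  have "a + c * s + d * s\<^sup>2 \<noteq> 0" if s: "0 \<le> Im s" for s
  proof -
    have "(\<Sum>S\<in>Pow U. principal_minor (?P s) (S \<union> insert i V) * principal_minor (?Q s) ((U - S) \<union> insert i V)) \<noteq> 0"
      by (rule insert.IH) (use insert.prems insert.hyps s in \<open>auto intro!: dissipative_add_diag\<close>)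
    also have "(\<Sum>S\<in>Pow U. principal_minor (?P s) (S \<union> insert i V) * principal_minor (?Q s) ((U - S) \<union> insert i V))
       = (\<Sum>S\<in>Pow U. (?p' S + s * ?p S) * (?q' S + s * ?q S))"
    proof (rule sum.cong[OF refl])
      fix S assume "S \<in> Pow U"
      then have h: "finite (S \<union> V)" "i \<notin> S \<union> V" "finite ((U - S) \<union> V)" "i \<notin> (U - S) \<union> V"
        using insert.prems insert.hyps disj finite_subset by auto
      show "principal_minor (?P s) (S \<union> insert i V) * principal_minor (?Q s) ((U - S) \<union> insert i V)
        = (?p' S + s * ?p S) * (?q' S + s * ?q S)"
        unfolding Un_insert_right principal_minor_add_diag[OF h(1,2)] principal_minor_add_diag[OF h(3,4)] ..
    qed
    also have "\<dots> = a + c * s + d * s\<^sup>2"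
      unfolding a_def c_def d_def sum_distrib_right sum.distrib[symmetric]
      by (rule sum.cong) (simp_all add: algebra_simps power2_eq_square)
    finally show ?thesis .
  qed
  from linear_coeff_nonzero[OF this d] have "c \<noteq> 0" .
  also have "c = (\<Sum>S\<in>Pow (insert i U). principal_minor P (S \<union> V) * principal_minor Q ((insert i U - S) \<union> V))"
    unfolding c_def sum_Pow_insert[OF insert.hyps]
  proof (rule sum.cong[OF refl])
    fix S assume "S \<in> Pow U"
    then have "insert i U - S = insert i (U - S)" "insert i U - insert i S = U - S"
      using insert.hyps by auto
    then show "?p S * ?q' S + ?p' S * ?q S =
      principal_minor P (S \<union> V) * principal_minor Q ((insert i U - S) \<union> V) +
      principal_minor P (insert i S \<union> V) * principal_minor Q ((insert i U - insert i S) \<union> V)"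
      by simp
  qed
  finally show ?case .
qed

section \<open>Determinants under rank one perturbations\<close>

lemma mult_col_row_mat:
  "mat n 1 (\<lambda>(i, _). u i) * mat 1 m (\<lambda>(_, j). v j) = mat n m (\<lambda>(i, j). u i * v j :: 'a::comm_ring_1)"
  by (rule eq_matI) (simp_all add: scalar_prod_def)

text \<open>The block matrix with rows \<open>(1, -v)\<close> and \<open>(u, I)\<close> is factored
  in two ways, once with the Schur complement \<open>I + u v\<^sup>T\<close> of the corner 1 and
  once with the scalar Schur complement \<open>1 + v\<^sup>T u\<close> of the corner
  \<open>I\<close>.\<close>

lemma det_one_plus_rank_one:
  fixes u v :: "nat \<Rightarrow> 'a::idom"
  shows "Determinant.det (mat n n (\<lambda>(i, j). (if i = j then 1 else 0) + u i * v j)) = 1 + (\<Sum>i<n. v i * u i)"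
proof -
  let ?U = "mat n 1 (\<lambda>(i, _). u i)" and ?V = "mat 1 n (\<lambda>(_, j). - v j)"
  let ?R = "mat n n (\<lambda>(i, j). (if i = j then 1 else 0) + u i * v j)"
  let ?c = "mat 1 1 (\<lambda>_. 1 + (\<Sum>i<n. v i * u i))"
  let ?L = "four_block_mat (1\<^sub>m 1) (0\<^sub>m 1 n) ?U (1\<^sub>m n)"
  have UV: "?U * ?V + ?R = 1\<^sub>m n"
    unfolding mult_col_row_mat by (rule eq_matI) simp_all
  have "?V * ?U = mat 1 1 (\<lambda>_. - (\<Sum>i<n. v i * u i))"
    by (rule eq_matI) (simp_all add: scalar_prod_def atLeast0LessThan sum_negf)
  then have VU: "?c + ?V * ?U = 1\<^sub>m 1"
    by (intro eq_matI) simp_all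
  have "?L * four_block_mat (1\<^sub>m 1) ?V (0\<^sub>m n 1) ?R
      = four_block_mat (1\<^sub>m 1) ?V ?U (1\<^sub>m n)"
    by (subst mult_four_block_mat[of _ 1 1 _ n _ n _ _ 1 _ n]) (simp_all add: UV del: One_nat_def)
  also have "\<dots> = four_block_mat ?c ?V (0\<^sub>m n 1) (1\<^sub>m n) * ?L"
    by (subst mult_four_block_mat[of _ 1 1 _ n _ n _ _ 1 _ n]) (simp_all add: VU del: One_nat_def)
  finally have "Determinant.det (?L * four_block_mat (1\<^sub>m 1) ?V (0\<^sub>m n 1) ?R)
     = Determinant.det (four_block_mat ?c ?V (0\<^sub>m n 1) (1\<^sub>m n) * ?L)" by simp
  moreover have "Determinant.det ?L = 1"
    by (subst det_four_block_mat_upper_right_zero[of _ 1 _ n]) simp_all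
  moreover have "Determinant.det (four_block_mat (1\<^sub>m 1) ?V (0\<^sub>m n 1) ?R) = Determinant.det ?R"
    by (subst det_four_block_mat_lower_left_zero[of _ 1 _ n]) simp_all
  moreover have "Determinant.det (four_block_mat ?c ?V (0\<^sub>m n 1) (1\<^sub>m n)) = 1 + (\<Sum>i<n. v i * u i)"
    by (subst det_four_block_mat_lower_left_zero[of _ 1 _ n]) (simp_all add: det_single)
  moreover have "?L \<in> carrier_mat (1 + n) (1 + n)"
    "four_block_mat (1\<^sub>m 1) ?V (0\<^sub>m n 1) ?R \<in> carrier_mat (1 + n) (1 + n)"
    "four_block_mat ?c ?V (0\<^sub>m n 1) (1\<^sub>m n) \<in> carrier_mat (1 + n) (1 + n)"
    by (rule four_block_carrier_mat; simp)+
  ultimately show ?thesis by (simp only: det_mult mult_1_left mult_1_right)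
qed

text \<open>Solving \<open>B w = u\<close> by the adjugate gives the factorization
  \<open>B + u v\<^sup>T = B (I + w v\<^sup>T)\<close>, which reduces the claim to a perturbation of
  the identity.\<close>

lemma det_plus_rank_one:
  fixes B :: "'a::field mat"
  assumes B: "B \<in> carrier_mat n n" and det: "Determinant.det B \<noteq> 0"
  shows "Determinant.det (mat n n (\<lambda>(i, j). B $$ (i, j) + u i * v j))
    = Determinant.det B + (\<Sum>i<n. \<Sum>j<n. v i * adj_mat B $$ (i, j) * u j)"
proof -
  let ?d = "Determinant.det B"
  note adj = adj_mat[OF B]
  define w where "w i = (\<Sum>j<n. adj_mat B $$ (i, j) * u j) / ?d" for i
  let ?R = "mat n n (\<lambda>(i, j). (if i = j then 1 else 0) + w i * v j)"
  have Bw: "(\<Sum>k<n. B $$ (i, k) * w k) = u i" if "i < n" for i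
  proof -
    have "(\<Sum>k<n. B $$ (i, k) * w k) = (\<Sum>k<n. \<Sum>j<n. B $$ (i, k) * adj_mat B $$ (k, j) * u j) / ?d"
      by (simp add: w_def sum_divide_distrib sum_distrib_left mult.assoc)
    also have "\<dots> = (\<Sum>j<n. (\<Sum>k<n. B $$ (i, k) * adj_mat B $$ (k, j)) * u j) / ?d"
      by (subst sum.swap) (simp add: sum_distrib_right)
    also have "\<dots> = (\<Sum>j<n. (B * adj_mat B) $$ (i, j) * u j) / ?d"
      using that B adj(1) by (simp add: scalar_prod_def atLeast0LessThan)
    also have "\<dots> = (\<Sum>j<n. if j = i then ?d * u j else 0) / ?d"
      unfolding adj(2) using that by (intro arg_cong[of _ _ "\<lambda>x. x / _"] sum.cong) auto
    also have "\<dots> = u i" using that det by simp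
    finally show ?thesis .
  qed
  have "mat n n (\<lambda>(i, j). B $$ (i, j) + u i * v j) = B * ?R"
  proof (rule eq_matI)
    fix i j assume "i < dim_row (B * ?R)" "j < dim_col (B * ?R)"
    then have ij: "i < n" "j < n" using B by auto
    have "(B * ?R) $$ (i, j) = (\<Sum>k<n. (if k = j then B $$ (i, k) else 0) + B $$ (i, k) * w k * v j)"
      using B ij by (auto simp: scalar_prod_def atLeast0LessThan algebra_simps intro!: sum.cong)
    also have "\<dots> = B $$ (i, j) + u i * v j"
      unfolding sum.distrib sum_distrib_right[symmetric] Bw[OF ij(1)] using ij by simp
    finally show "mat n n (\<lambda>(i, j). B $$ (i, j) + u i * v j) $$ (i, j) = (B * ?R) $$ (i, j)"
      using ij by simp
  qed (use B in auto)
  then have "Determinant.det (mat n n (\<lambda>(i, j). B $$ (i, j) + u i * v j)) = ?d * (1 + (\<Sum>i<n. v i * w i))"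
    using B by (simp add: det_mult[of _ n] det_one_plus_rank_one)
  also have "\<dots> = ?d + (\<Sum>i<n. \<Sum>j<n. v i * adj_mat B $$ (i, j) * u j)"
    using det by (simp add: w_def distrib_left sum_distrib_left sum_divide_distrib mult.assoc)
  finally show ?thesis .
qed

section \<open>Evaluation of real polynomials at real and complex points\<close>

abbreviation (input) rpoly :: "real poly \<Rightarrow> 'a::real_field \<Rightarrow> 'a" where
  "rpoly p z \<equiv> poly (map_poly of_real p) z"

lemma rpoly_of_real: "rpoly p (of_real x) = of_real (poly p x)"
  by (rule of_real_hom.poly_map_poly)

lemma rpoly_real [simp]: "rpoly p x = poly p (x::real)"
  using rpoly_of_real[of p x, where 'a = real] by simp

text \<open>Interpreted wherever an evaluation has to be moved through sums, products, minors or
  adjugates of polynomial matrices.\<close>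

lemma comm_ring_hom_rpoly: "comm_ring_hom (\<lambda>p. rpoly p (z::'a::real_field))"
proof -
  interpret map_poly_comm_ring_hom "of_real :: real \<Rightarrow> 'a" ..
  show ?thesis by unfold_locales (simp_all add: hom_distribs)
qed

lemma rpoly_smult [simp]: "rpoly (Polynomial.smult c p) z = of_real c * rpoly p z"
  by (simp add: of_real_hom.map_poly_hom_smult)

context comm_ring_hom
begin

lemma hom_principal_minor: "hom (principal_minor P T) = principal_minor (\<lambda>i j. hom (P i j)) T"
  by (simp add: principal_minor_def hom_distribs)

lemma map_mat_mat_delete: "map_mat hom (mat_delete B i j) = mat_delete (map_mat hom B) i j"
  by (rule eq_matI) (auto simp: mat_delete_def)

lemma hom_adj_mat:
  assumes "i < dim_row B" "j < dim_col B"
  shows "hom (adj_mat B $$ (i, j)) = adj_mat (map_mat hom B) $$ (i, j)"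
  using assms by (simp add: adj_mat_def cofactor_def hom_distribs hom_det[symmetric] map_mat_mat_delete del: hom_det)

end

subsection \<open>Cut matrices\<close>

lemma cut_mat_carrier [simp]: "A \<in> carrier_mat n n \<Longrightarrow> cut_mat A \<epsilon> \<in> carrier_mat n n"
  by (auto simp: cut_mat_def mat_diag_def)

lemma cut_mat_index:
  assumes "A \<in> carrier_mat n n" "i < n" "j < n"
  shows "cut_mat A \<epsilon> $$ (i, j) = (1 - \<epsilon> i * \<epsilon> j) / 2 * A $$ (i, j)"
proof -
  have "mat_diag n \<epsilon> * A * mat_diag n \<epsilon> = mat n n (\<lambda>(i, j). \<epsilon> i * A $$ (i, j) * \<epsilon> j)"
    by (subst mat_diag_mult_left[OF assms(1)], subst mat_diag_mult_right) (auto intro: eq_matI)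
  then show ?thesis using assms by (simp add: cut_mat_def field_simps)
qed

lemma char_poly_matrix_index:
  assumes "M \<in> carrier_mat n n" "i < n" "j < n"
  shows "char_poly_matrix M $$ (i, j) = (if i = j then [:0, 1:] else 0) + [:- M $$ (i, j):]"
  using assms by (simp add: char_poly_matrix_def)

lemma rpoly_char_poly_matrix_index:
  assumes "M \<in> carrier_mat n n" "i < n" "j < n"
  shows "rpoly (char_poly_matrix M $$ (i, j)) z = (if i = j then z else 0) - of_real (M $$ (i, j))"
  using assms by (simp add: char_poly_matrix_index of_real_hom.map_poly_pCons_hom)

lemma rpoly_principal_minor_char_poly_matrix:
  assumes M: "M \<in> carrier_mat n n" and S: "S \<subseteq> {..<n}"
  shows "rpoly (principal_minor (\<lambda>i j. char_poly_matrix M $$ (i, j)) S) z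
    = principal_minor (\<lambda>i j. (if i = j then z else 0) - of_real (M $$ (i, j))) S"
proof -
  interpret comm_ring_hom "\<lambda>p. rpoly p z" by (rule comm_ring_hom_rpoly)
  show ?thesis
    unfolding hom_principal_minor
    by (rule principal_minor_cong, rule rpoly_char_poly_matrix_index[OF M]) (use S in auto)
qed

lemma rpoly_char_poly:
  assumes "M \<in> carrier_mat n n"
  shows "rpoly (char_poly M) z
    = principal_minor (\<lambda>i j. (if i = j then z else 0) - of_real (M $$ (i, j))) {..<n}"
  unfolding char_poly_def det_eq_principal_minor[OF char_poly_matrix_closed[OF assms]]
  by (rule rpoly_principal_minor_char_poly_matrix[OF assms]) simp

lemma submatrix_carrier:
  assumes M: "M \<in> carrier_mat n n" and S: "S \<subseteq> {..<n}"
  shows "submatrix M S S \<in> carrier_mat (card S) (card S)"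
proof -
  have "{i. i < n \<and> i \<in> S} = S" using S by auto
  then show ?thesis by (intro carrier_matI) (simp_all only: dim_submatrix carrier_matD[OF M])
qed

lemma submatrix_principal_index:
  assumes M: "M \<in> carrier_mat n n" and S: "S \<subseteq> {..<n}" and ij: "i < card S" "j < card S"
  shows "submatrix M S S $$ (i, j) = M $$ (pick S i, pick S j)"
  using submatrix_carrier[OF M S] ij
  by (intro submatrix_index) (metis carrier_matD dim_submatrix)+

lemma char_poly_submatrix:
  assumes M: "M \<in> carrier_mat n n" and S: "S \<subseteq> {..<n}"
  shows "char_poly (submatrix M S S) = principal_minor (\<lambda>i j. char_poly_matrix M $$ (i, j)) S"
proof -
  note C = submatrix_carrier[OF M S]
  have "char_poly_matrix (submatrix M S S) = submatrix (char_poly_matrix M) S S"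
  proof (rule eq_matI)
    fix i j assume "i < dim_row (submatrix (char_poly_matrix M) S S)" "j < dim_col (submatrix (char_poly_matrix M) S S)"
    then have ij: "i < card S" "j < card S"
      using submatrix_carrier[OF char_poly_matrix_closed[OF M] S] by auto
    have "pick S i < n" "pick S j < n" using ij S by (auto dest: pick_in_set_le)
    moreover have "pick S i = pick S j \<longleftrightarrow> i = j" using inj_on_pick[of S] ij by (auto dest: inj_onD)
    ultimately show "char_poly_matrix (submatrix M S S) $$ (i, j) = submatrix (char_poly_matrix M) S S $$ (i, j)"
      by (simp add: char_poly_matrix_index[OF C ij] char_poly_matrix_index[OF M] ij
          submatrix_principal_index[OF char_poly_matrix_closed[OF M] S ij] submatrix_principal_index[OF M S ij])
  qed (use char_poly_matrix_closed[OF C] submatrix_carrier[OF char_poly_matrix_closed[OF M] S] in auto)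
  then show ?thesis
    by (simp add: char_poly_def det_submatrix[OF char_poly_matrix_closed[OF M] S])
qed

lemma uminus_submatrix:
  assumes M: "M \<in> carrier_mat n n" and S: "S \<subseteq> {..<n}"
  shows "- submatrix M S S = submatrix (- M) S S"
proof -
  have M': "- M \<in> carrier_mat n n" using M by simp
  show ?thesis
  proof (rule eq_matI)
    fix i j assume "i < dim_row (submatrix (- M) S S)" "j < dim_col (submatrix (- M) S S)"
    then have ij: "i < card S" "j < card S" using submatrix_carrier[OF M' S] by auto
    then have "pick S i < n" "pick S j < n" using S by (auto dest: pick_in_set_le)
    then show "(- submatrix M S S) $$ (i, j) = submatrix (- M) S S $$ (i, j)"
      using submatrix_carrier[OF M S] ij M
      by (simp add: submatrix_principal_index[OF M S ij] submatrix_principal_index[OF M' S ij])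
  qed (use submatrix_carrier[OF M S] submatrix_carrier[OF M' S] in auto)
qed

lemma rpoly_q_poly:
  assumes A: "A \<in> carrier_mat n n"
  shows "rpoly (q_poly A) z = (\<Sum>S\<in>Pow {..<n}.
      principal_minor (\<lambda>i j. (if i = j then z else 0) - of_real (A $$ (i, j))) S *
      principal_minor (\<lambda>i j. (if i = j then z else 0) + of_real (A $$ (i, j))) ({..<n} - S)) / 2 ^ n"
proof -
  interpret comm_ring_hom "\<lambda>p. rpoly p z" by (rule comm_ring_hom_rpoly)
  have A': "- A \<in> carrier_mat n n" using A by simp
  have "rpoly (q_poly A) z = (\<Sum>S\<in>Pow {..<n}.
      rpoly (char_poly (submatrix A S S)) z *
      rpoly (char_poly (- submatrix A ({..<n} - S) ({..<n} - S))) z) / 2 ^ n"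
    using A by (simp add: q_poly_def hom_sum hom_mult of_real_divide)
  also have "\<dots> = (\<Sum>S\<in>Pow {..<n}.
      principal_minor (\<lambda>i j. (if i = j then z else 0) - of_real (A $$ (i, j))) S *
      principal_minor (\<lambda>i j. (if i = j then z else 0) + of_real (A $$ (i, j))) ({..<n} - S)) / 2 ^ n"
  proof (rule arg_cong[of _ _ "\<lambda>x. x / _"], rule sum.cong[OF refl])
    fix S assume "S \<in> Pow {..<n}"
    then have S: "S \<subseteq> {..<n}" by simp
    have S': "{..<n} - S \<subseteq> {..<n}" by blast
    have 1: "rpoly (char_poly (submatrix A S S)) z
      = principal_minor (\<lambda>i j. (if i = j then z else 0) - of_real (A $$ (i, j))) S"
      by (simp only: char_poly_submatrix[OF A S] rpoly_principal_minor_char_poly_matrix[OF A S])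
    have "rpoly (char_poly (- submatrix A ({..<n} - S) ({..<n} - S))) z
      = principal_minor (\<lambda>i j. (if i = j then z else 0) - of_real ((- A) $$ (i, j))) ({..<n} - S)"
      by (simp only: uminus_submatrix[OF A S'] char_poly_submatrix[OF A' S'] rpoly_principal_minor_char_poly_matrix[OF A' S'])
    also have "\<dots> = principal_minor (\<lambda>i j. (if i = j then z else 0) + of_real (A $$ (i, j))) ({..<n} - S)"
      by (rule principal_minor_cong) (use A in auto)
    finally show "rpoly (char_poly (submatrix A S S)) z *
      rpoly (char_poly (- submatrix A ({..<n} - S) ({..<n} - S))) z =
      principal_minor (\<lambda>i j. (if i = j then z else 0) - of_real (A $$ (i, j))) S *
      principal_minor (\<lambda>i j. (if i = j then z else 0) + of_real (A $$ (i, j))) ({..<n} - S)"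
      unfolding 1 by simp
  qed
  finally show ?thesis .
qed

text \<open>Since \<open>D\<^sub>\<epsilon>\<close> squares to the identity,
  \<open>zI - M\<^sub>\<epsilon> + R\<close> is half the sum of \<open>zI - A + 2R\<close> and
  \<open>D\<^sub>\<epsilon> (zI + A) D\<^sub>\<epsilon>\<close>. The perturbation is loaded on the
  first summand alone, which costs the factor 2 and keeps it free of signs.\<close>

lemma sum_signs_principal_minor_cut_mat:
  fixes z :: "'a::real_field"
  assumes A: "A \<in> carrier_mat n n"
  shows "(\<Sum>\<epsilon>\<in>signs n. principal_minor (\<lambda>i j. (if i = j then z else 0) - of_real (cut_mat A \<epsilon> $$ (i, j)) + R i j) {..<n})
    = (\<Sum>S\<in>Pow {..<n}.
      principal_minor (\<lambda>i j. (if i = j then z else 0) - of_real (A $$ (i, j)) + 2 * R i j) S *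
      principal_minor (\<lambda>i j. (if i = j then z else 0) + of_real (A $$ (i, j))) ({..<n} - S))"
  unfolding sum_signs_principal_minor[symmetric]
proof (rule sum.cong[OF refl], rule principal_minor_cong)
  fix \<epsilon> i j assume \<epsilon>: "\<epsilon> \<in> signs n" and ij: "i \<in> {..<n}" "j \<in> {..<n}"
  have "of_real (\<epsilon> i * \<epsilon> i) = (1::'a)" using signs_square[OF \<epsilon>] ij by (simp del: of_real_mult)
  then have "(if i = j then z else 0) = (if i = j then z else 0) * (1 + of_real (\<epsilon> i * \<epsilon> j)) / 2"
    by (cases "i = j") (simp_all del: of_real_mult)
  then show "(if i = j then z else 0) - of_real (cut_mat A \<epsilon> $$ (i, j)) + R i j =
    ((if i = j then z else 0) - of_real (A $$ (i, j)) + 2 * R i j +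
     of_real (\<epsilon> i * \<epsilon> j) * ((if i = j then z else 0) + of_real (A $$ (i, j)))) / 2"
    using ij by (simp add: cut_mat_index[OF A] field_simps)
qed

text \<open>The case \<open>R = 0\<close> of the averaging identity at all real points. It yields
  that \<open>q_poly A\<close> is monic, and later it cancels the mean of the characteristic
  polynomials in the expansion at infinity.\<close>

lemma q_poly_eq_average:
  assumes A: "A \<in> carrier_mat n n"
  shows "q_poly A = Polynomial.smult (1 / 2 ^ n) (\<Sum>\<epsilon>\<in>signs n. char_poly (cut_mat A \<epsilon>))"
proof -
  have "poly (q_poly A) x = poly (Polynomial.smult (1 / 2 ^ n) (\<Sum>\<epsilon>\<in>signs n. char_poly (cut_mat A \<epsilon>))) x" for x
  proof -
    have "poly (q_poly A) x = (\<Sum>\<epsilon>\<in>signs n. principal_minor (\<lambda>i j. (if i = j then x else 0) - cut_mat A \<epsilon> $$ (i, j)) {..<n}) / 2 ^ n"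
      using rpoly_q_poly[OF A, of x] sum_signs_principal_minor_cut_mat[OF A, where z = x and R = "\<lambda>_ _. 0"] by simp
    also have "\<dots> = (\<Sum>\<epsilon>\<in>signs n. poly (char_poly (cut_mat A \<epsilon>)) x) / 2 ^ n"
      using rpoly_char_poly[OF cut_mat_carrier[OF A], where z = x] by simp
    finally show ?thesis by (simp add: poly_sum)
  qed
  then show ?thesis by (metis poly_eq_poly_eq_iff ext)
qed

lemma q_poly_monic:
  assumes A: "A \<in> carrier_mat n n"
  shows "degree (q_poly A) = n" "Polynomial.coeff (q_poly A) n = 1"
proof -
  have d: "degree (char_poly (cut_mat A \<epsilon>)) = n" "Polynomial.coeff (char_poly (cut_mat A \<epsilon>)) n = 1" for \<epsilon>
    using degree_monic_char_poly[OF cut_mat_carrier[OF A]] by auto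
  show c: "Polynomial.coeff (q_poly A) n = 1"
    unfolding q_poly_eq_average[OF A] by (simp add: coeff_sum d)
  have "degree (q_poly A) \<le> n"
    unfolding q_poly_eq_average[OF A]
    by (intro order.trans[OF degree_smult_le] degree_sum_le) (simp_all add: d)
  then show "degree (q_poly A) = n" using c by (intro antisym le_degree) auto
qed

text \<open>The entries of \<open>G_mat\<close> as polynomials, so that they have degrees and
  divisibility relations and can be evaluated in the upper half plane.\<close>

definition G_poly :: "real mat \<Rightarrow> nat \<Rightarrow> nat \<Rightarrow> real poly" where
  "G_poly A i j = Polynomial.smult (1 / 2 ^ dim_row A)
     (\<Sum>\<epsilon>\<in>signs (dim_row A). adj_mat (char_poly_matrix (cut_mat A \<epsilon>)) $$ (i, j))"

lemma rpoly_adj_char_poly_matrix: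
  assumes M: "M \<in> carrier_mat n n" and ij: "i < n" "j < n"
  shows "rpoly (adj_mat (char_poly_matrix M) $$ (i, j)) z
    = adj_mat (mat n n (\<lambda>(i, j). (if i = j then z else 0) - of_real (M $$ (i, j)))) $$ (i, j)"
proof -
  interpret comm_ring_hom "\<lambda>p. rpoly p z" by (rule comm_ring_hom_rpoly)
  have "map_mat (\<lambda>p. rpoly p z) (char_poly_matrix M) = mat n n (\<lambda>(i, j). (if i = j then z else 0) - of_real (M $$ (i, j)))"
    by (rule eq_matI) (simp_all add: rpoly_char_poly_matrix_index[OF M] carrier_matD[OF char_poly_matrix_closed[OF M]])
  then show ?thesis using hom_adj_mat[of i "char_poly_matrix M" j] char_poly_matrix_closed[OF M] ij by simp
qed

lemma rpoly_G_poly: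
  assumes A: "A \<in> carrier_mat n n" and ij: "i < n" "j < n"
  shows "rpoly (G_poly A i j) z = (\<Sum>\<epsilon>\<in>signs n.
    adj_mat (mat n n (\<lambda>(i, j). (if i = j then z else 0) - of_real (cut_mat A \<epsilon> $$ (i, j)))) $$ (i, j)) / 2 ^ n"
proof -
  interpret comm_ring_hom "\<lambda>p. rpoly p z" by (rule comm_ring_hom_rpoly)
  show ?thesis using A ij
    by (simp add: G_poly_def hom_sum of_real_divide rpoly_adj_char_poly_matrix[OF cut_mat_carrier[OF A] ij])
qed

lemma G_mat_index:
  assumes A: "A \<in> carrier_mat n n" and ij: "i < n" "j < n"
  shows "G_mat A x $$ (i, j) = poly (G_poly A i j) x"
proof -
  have "x \<cdot>\<^sub>m 1\<^sub>m n - cut_mat A \<epsilon> = mat n n (\<lambda>(i, j). (if i = j then x else 0) - of_real (cut_mat A \<epsilon> $$ (i, j)))" for \<epsilon>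
    using cut_mat_carrier[OF A, of \<epsilon>] by (intro eq_matI) auto
  then show ?thesis
    using A ij rpoly_G_poly[OF A ij, of x] by (simp add: G_mat_def expectation_sign_pmf)
qed

lemma Im_quadratic_form_real_symmetric:
  assumes "\<And>i j. i \<in> T \<Longrightarrow> j \<in> T \<Longrightarrow> B i j = B j i"
  shows "Im (\<Sum>i\<in>T. \<Sum>j\<in>T. cnj (u i) * of_real (B i j) * u j) = 0"
proof -
  let ?s = "\<Sum>i\<in>T. \<Sum>j\<in>T. cnj (u i) * of_real (B i j) * u j"
  have "cnj ?s = (\<Sum>i\<in>T. \<Sum>j\<in>T. u i * of_real (B i j) * cnj (u j))" by simp
  also have "\<dots> = (\<Sum>j\<in>T. \<Sum>i\<in>T. u i * of_real (B i j) * cnj (u j))" by (rule sum.swap)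
  also have "\<dots> = ?s" by (intro sum.cong refl) (simp add: assms mult_ac)
  finally have "?s \<in> \<real>" by (simp only: Reals_cnj_iff)
  then show ?thesis by (simp only: complex_is_Real_iff)
qed

text \<open>The imaginary part of the form at \<open>u\<close> splits into \<open>Im z\<close> times
  the squared norm of \<open>u\<close>, a zero contribution of the real symmetric \<open>B\<close>,
  and \<open>Im w\<close> times the squared modulus of the sum of \<open>v i * u i\<close>.\<close>

lemma dissipative_shift:
  assumes "finite T" and sym: "\<And>i j. i \<in> T \<Longrightarrow> j \<in> T \<Longrightarrow> B i j = B j i"
    and z: "0 < Im z" and w: "0 \<le> Im w"
  shows "dissipative (\<lambda>i j. (if i = j then z else 0) + of_real (B i j) + w * of_real (v i * v j)) T"
  unfolding dissipative_def
proof (intro allI impI)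
  fix u :: "nat \<Rightarrow> complex" assume u: "\<exists>i\<in>T. u i \<noteq> 0"
  have "(\<Sum>i\<in>T. \<Sum>j\<in>T. cnj (u i) * (if i = j then z else 0) * u j) = (\<Sum>i\<in>T. cnj (u i) * z * u i)"
    using \<open>finite T\<close> by (intro sum.cong refl) (simp add: if_distrib[of "\<lambda>x. _ * x * _"] if_distrib[of "\<lambda>x. x * _"] if_distrib[of "\<lambda>x. _ * x"] cong: if_cong)
  also have "\<dots> = of_real (\<Sum>i\<in>T. (cmod (u i))\<^sup>2) * z"
    unfolding of_real_sum complex_norm_square sum_distrib_right by (simp add: mult_ac)
  finally have 1: "0 < Im (\<Sum>i\<in>T. \<Sum>j\<in>T. cnj (u i) * (if i = j then z else 0) * u j)"
    using z u \<open>finite T\<close> by (auto simp del: of_real_power of_real_sum intro!: mult_pos_pos sum_pos2)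
  have "(\<Sum>i\<in>T. \<Sum>j\<in>T. cnj (u i) * (w * of_real (v i * v j)) * u j)
    = (\<Sum>i\<in>T. \<Sum>j\<in>T. w * (cnj (of_real (v i) * u i) * (of_real (v j) * u j)))"
    by (simp add: mult_ac)
  also have "\<dots> = w * ((\<Sum>i\<in>T. cnj (of_real (v i) * u i)) * (\<Sum>j\<in>T. of_real (v j) * u j))"
    by (subst sum_product) (simp only: sum_distrib_left)
  also have "\<dots> = of_real ((cmod (\<Sum>i\<in>T. of_real (v i) * u i))\<^sup>2) * w"
    by (subst complex_norm_square) (simp add: mult_ac)
  finally have 2: "0 \<le> Im (\<Sum>i\<in>T. \<Sum>j\<in>T. cnj (u i) * (w * of_real (v i * v j)) * u j)"
    using w by (simp del: of_real_power)
  have 3: "Im (\<Sum>i\<in>T. \<Sum>j\<in>T. cnj (u i) * of_real (B i j) * u j) = 0"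
    by (rule Im_quadratic_form_real_symmetric) (rule sym)
  show "0 < Im (\<Sum>i\<in>T. \<Sum>j\<in>T. cnj (u i) * ((if i = j then z else 0) + of_real (B i j) + w * of_real (v i * v j)) * u j)"
    unfolding distrib_left distrib_right sum.distrib plus_complex.simps
    using 1 2 3 by linarith
qed

text \<open>The parameter \<open>w\<close> serves twice: \<open>w = 0\<close> excludes zeros of
  \<open>q_poly A\<close> in the open upper half plane, and letting \<open>w\<close> range over the
  closed half plane determines the sign of the imaginary part of
  \<open>v\<^sup>T F v\<close>.\<close>

lemma q_plus_rank_one_nonzero:
  assumes A: "A \<in> carrier_mat n n" and sym: "transpose_mat A = A"
    and z: "0 < Im z" and w: "0 \<le> Im w"
  shows "rpoly (q_poly A) z + w * (\<Sum>i<n. \<Sum>j<n. of_real (v i * v j) * rpoly (G_poly A i j) z) \<noteq> 0"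
proof -
  let ?B = "\<lambda>\<epsilon>. mat n n (\<lambda>(i, j). (if i = j then z else 0) - complex_of_real (cut_mat A \<epsilon> $$ (i, j)))"
  have A_sym: "A $$ (i, j) = A $$ (j, i)" if "i < n" "j < n" for i j
    using that A sym by (metis carrier_matD index_transpose_mat(1))
  have det_B: "Determinant.det (?B \<epsilon>) = rpoly (char_poly (cut_mat A \<epsilon>)) z" for \<epsilon>
    unfolding rpoly_char_poly[OF cut_mat_carrier[OF A]] principal_minor_eq_det ..
  \<comment> \<open>The rank one formula divides by the determinant; each
    \<open>zI - M\<^sub>\<epsilon>\<close> is itself dissipative, hence invertible.\<close>
  have det_B_nonzero: "Determinant.det (?B \<epsilon>) \<noteq> 0" for \<epsilon>
  proof -
    have "principal_minor (\<lambda>i j. (if i = j then z else 0) + of_real (- cut_mat A \<epsilon> $$ (i, j)) + 0 * of_real (v i * v j)) {..<n} \<noteq> 0"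
      by (intro dissipative_principal_minor_nonzero dissipative_shift z)
        (auto simp: cut_mat_index[OF A] A_sym mult_ac)
    then show ?thesis by (simp add: principal_minor_eq_det)
  qed
  have rank_one: "principal_minor (\<lambda>i j. (if i = j then z else 0) - of_real (cut_mat A \<epsilon> $$ (i, j)) + w * of_real (v i * v j)) {..<n}
    = rpoly (char_poly (cut_mat A \<epsilon>)) z + w * (\<Sum>i<n. \<Sum>j<n. of_real (v i * v j) * adj_mat (?B \<epsilon>) $$ (i, j))" for \<epsilon>
  proof -
    have "principal_minor (\<lambda>i j. (if i = j then z else 0) - of_real (cut_mat A \<epsilon> $$ (i, j)) + w * of_real (v i * v j)) {..<n}
      = Determinant.det (mat n n (\<lambda>(i, j). ?B \<epsilon> $$ (i, j) + (w * of_real (v i)) * of_real (v j)))"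
      unfolding principal_minor_eq_det by (rule arg_cong[of _ _ Determinant.det], rule eq_matI) simp_all
    also have "\<dots> = Determinant.det (?B \<epsilon>) + (\<Sum>i<n. \<Sum>j<n. of_real (v i) * adj_mat (?B \<epsilon>) $$ (i, j) * (w * of_real (v j)))"
      by (rule det_plus_rank_one[OF _ det_B_nonzero]) simp
    finally show ?thesis unfolding det_B by (simp add: sum_distrib_left mult_ac)
  qed
  have "rpoly (q_poly A) z + w * (\<Sum>i<n. \<Sum>j<n. of_real (v i * v j) * rpoly (G_poly A i j) z)
    = (\<Sum>\<epsilon>\<in>signs n. rpoly (char_poly (cut_mat A \<epsilon>)) z + w * (\<Sum>i<n. \<Sum>j<n. of_real (v i * v j) * adj_mat (?B \<epsilon>) $$ (i, j))) / 2 ^ n"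
  proof -
    interpret comm_ring_hom "\<lambda>p. rpoly p z" by (rule comm_ring_hom_rpoly)
    have "(\<Sum>i<n. \<Sum>j<n. of_real (v i * v j) * rpoly (G_poly A i j) z)
      = (\<Sum>i<n. \<Sum>j<n. \<Sum>\<epsilon>\<in>signs n. of_real (v i * v j) * adj_mat (?B \<epsilon>) $$ (i, j)) / 2 ^ n"
      by (simp add: rpoly_G_poly[OF A] sum_distrib_left sum_divide_distrib)
    also have "(\<Sum>i<n. \<Sum>j<n. \<Sum>\<epsilon>\<in>signs n. of_real (v i * v j) * adj_mat (?B \<epsilon>) $$ (i, j))
      = (\<Sum>i<n. \<Sum>\<epsilon>\<in>signs n. \<Sum>j<n. of_real (v i * v j) * adj_mat (?B \<epsilon>) $$ (i, j))"
      by (rule sum.cong[OF refl], rule sum.swap)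
    also have "\<dots> = (\<Sum>\<epsilon>\<in>signs n. \<Sum>i<n. \<Sum>j<n. of_real (v i * v j) * adj_mat (?B \<epsilon>) $$ (i, j))"
      by (rule sum.swap)
    finally have G: "(\<Sum>i<n. \<Sum>j<n. of_real (v i * v j) * rpoly (G_poly A i j) z)
      = (\<Sum>\<epsilon>\<in>signs n. \<Sum>i<n. \<Sum>j<n. of_real (v i * v j) * adj_mat (?B \<epsilon>) $$ (i, j)) / 2 ^ n" .
    have q: "rpoly (q_poly A) z = (\<Sum>\<epsilon>\<in>signs n. rpoly (char_poly (cut_mat A \<epsilon>)) z) / 2 ^ n"
      by (simp add: q_poly_eq_average[OF A] hom_sum of_real_divide)
    show ?thesis
      unfolding G q by (simp only: sum.distrib sum_distrib_left[symmetric] add_divide_distrib times_divide_eq_right)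
  qed
  also have "\<dots> = (\<Sum>S\<in>Pow {..<n}.
      principal_minor (\<lambda>i j. (if i = j then z else 0) - of_real (A $$ (i, j)) + 2 * (w * of_real (v i * v j))) S *
      principal_minor (\<lambda>i j. (if i = j then z else 0) + of_real (A $$ (i, j))) ({..<n} - S)) / 2 ^ n"
    unfolding rank_one[symmetric] sum_signs_principal_minor_cut_mat[OF A] ..
  also have "\<dots> \<noteq> 0"
  proof -
    have "dissipative (\<lambda>i j. (if i = j then z else 0) + of_real (- A $$ (i, j)) + (2 * w) * of_real (v i * v j)) {..<n}"
      using z w by (intro dissipative_shift) (auto simp: A_sym)
    then have P: "dissipative (\<lambda>i j. (if i = j then z else 0) - of_real (A $$ (i, j)) + 2 * (w * of_real (v i * v j))) ({..<n} \<union> {})"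
      by (simp add: mult.assoc)
    have "dissipative (\<lambda>i j. (if i = j then z else 0) + of_real (A $$ (i, j)) + 0 * of_real (v i * v j)) {..<n}"
      using z by (intro dissipative_shift) (auto simp: A_sym)
    then have Q: "dissipative (\<lambda>i j. (if i = j then z else 0) + of_real (A $$ (i, j))) ({..<n} \<union> {})" by simp
    show ?thesis using sum_principal_minor_products_nonzero[OF _ _ _ P Q] by simp
  qed
  finally show ?thesis .
qed

subsection \<open>Partial fractions\<close>

lemma Im_quotient_nonpos:
  assumes nz: "\<And>w. 0 \<le> Im w \<Longrightarrow> a + w * b \<noteq> 0"
  shows "Im (b / a) \<le> 0"
proof (rule ccontr)
  assume "\<not> Im (b / a) \<le> 0"
  then have pos: "0 < Im (b / a)" by simp
  then have "a \<noteq> 0" "b \<noteq> 0" by auto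
  have "Im (- inverse h) = Im h / ((Re h)\<^sup>2 + (Im h)\<^sup>2)" for h by simp
  then have "Im (- inverse (b / a)) = Im (b / a) / ((Re (b / a))\<^sup>2 + (Im (b / a))\<^sup>2)" .
  also have "\<dots> \<ge> 0" using pos by simp
  finally have "a + (- inverse (b / a)) * b \<noteq> 0" by (rule nz)
  then show False using \<open>a \<noteq> 0\<close> \<open>b \<noteq> 0\<close> by simp
qed

lemma rpoly_root_real:
  fixes z :: complex
  assumes nz: "\<And>z. 0 < Im z \<Longrightarrow> rpoly q z \<noteq> 0" and root: "rpoly q z = 0"
  shows "z \<in> \<real>"
proof -
  have "rpoly q (cnj z) = cnj (rpoly q z)"
    by (rule poly_cnj_real[symmetric]) (simp add: coeff_map_poly)
  then have "Im z = 0" using nz[of z] nz[of "cnj z"] root by (cases "Im z" "0::real" rule: linorder_cases) auto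
  then show ?thesis by (simp add: complex_is_Real_iff)
qed

text \<open>At a pole of order \<open>p \<ge> 2\<close> the values of \<open>g / q\<close> on a half circle around the pole would take
  every argument, so the imaginary part could not keep its sign.\<close>

lemma order_le_Suc_order:
  fixes q g :: "real poly"
  assumes "q \<noteq> 0" "g \<noteq> 0"
    and Im: "\<And>z. 0 < Im z \<Longrightarrow> Im (rpoly g z / rpoly q z) \<le> 0"
  shows "Polynomial.order a q \<le> Suc (Polynomial.order a g)"
proof (rule ccontr)
  define m k where "m = Polynomial.order a q" and "k = Polynomial.order a g"
  define p where "p = m - k"
  assume "\<not> ?thesis"
  then have p: "m = k + p" "2 \<le> p" by (auto simp: m_def k_def p_def)
  obtain q1 where q1: "q = [:- a, 1:] ^ m * q1" "\<not> [:- a, 1:] dvd q1"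
    using order_decomp[OF \<open>q \<noteq> 0\<close>] unfolding m_def by blast
  obtain g1 where g1: "g = [:- a, 1:] ^ k * g1" "\<not> [:- a, 1:] dvd g1"
    using order_decomp[OF \<open>g \<noteq> 0\<close>] unfolding k_def by blast
  define c where "c = poly g1 a / poly q1 a"
  have nz: "poly q1 a \<noteq> 0" "poly g1 a \<noteq> 0" using q1(2) g1(2) by (simp_all add: poly_eq_0_iff_dvd)
  \<comment> \<open>Along the ray from \<open>a\<close> in direction \<open>u\<close>,
    multiplication of \<open>g / q\<close> by the positive number \<open>r ^ p\<close> does not
    change the sign of the imaginary part; as \<open>r\<close> tends to 0, only the leading term
    \<open>c / u ^ p\<close> is left.\<close>
  have ray: "Im (of_real c / u ^ p) \<le> 0" if u: "0 < Im u" for u :: complex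
  proof -
    let ?f = "\<lambda>r::real. rpoly g1 (of_real a + of_real r * u) / rpoly q1 (of_real a + of_real r * u) / u ^ p"
    have "Im (?f r) \<le> 0" if r: "0 < r" for r
    proof -
      interpret comm_ring_hom "\<lambda>p. rpoly p (of_real a + of_real r * u)" by (rule comm_ring_hom_rpoly)
      have lin: "rpoly [:- a, 1:] (of_real a + of_real r * u) = of_real r * u"
        by (simp add: of_real_hom.map_poly_pCons_hom)
      have "u \<noteq> 0" using u by auto
      have "rpoly g (of_real a + of_real r * u) / rpoly q (of_real a + of_real r * u)
        = ?f r / of_real (r ^ p)"
        using r \<open>u \<noteq> 0\<close> unfolding q1(1) g1(1) p(1) hom_mult hom_power lin
        by (simp add: power_add power_mult_distrib)
      then have "Im (?f r / of_real (r ^ p)) \<le> 0" using Im[of "of_real a + of_real r * u"] r u by simp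
      then have "Im (?f r) / r ^ p \<le> 0" by (simp only: Im_divide_of_real)
      then show ?thesis using r by (simp only: pos_divide_le_eq zero_less_power mult_zero_left)
    qed
    then have ev: "eventually (\<lambda>r. Im (?f r) \<le> 0) (at_right 0)"
      by (simp add: eventually_at_right_less eventually_at_filter)
    have "((\<lambda>r. Im (?f r)) \<longlongrightarrow> Im (rpoly g1 (of_real a + of_real 0 * u) / rpoly q1 (of_real a + of_real 0 * u) / u ^ p)) (at_right 0)"
      using nz u by (intro tendsto_intros) (auto simp: rpoly_of_real)
    then have "((\<lambda>r. Im (?f r)) \<longlongrightarrow> Im (of_real c / u ^ p)) (at_right 0)"
      by (simp add: rpoly_of_real c_def)
    then show ?thesis by (rule tendsto_upperbound[OF _ ev]) simp
  qed
  \<comment> \<open>The direction \<open>cis (t * pi / p)\<close> lies in the upper half plane for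
    these \<open>t\<close>, and its \<open>p\<close>-th power is
    \<open>cis (t * pi)\<close>.\<close>
  have half: "Im (of_real c / cis (t * pi)) \<le> 0" if "0 < t" "t < p" for t :: real
  proof -
    have "cis (t * pi / p) ^ p = cis (t * pi)"
      unfolding Complex.DeMoivre using p(2) by simp
    moreover have "0 < Im (cis (t * pi / p))"
      using that p(2) by (auto intro!: sin_gt_zero simp: field_simps)
    ultimately show ?thesis using ray[of "cis (t * pi / p)"] by simp
  qed
  \<comment> \<open>The assumption \<open>2 \<le> p\<close> enters here: it admits both
    \<open>t = 1/2\<close> and \<open>t = 3/2\<close>, which force \<open>c\<close> to be
    nonnegative and nonpositive.\<close>
  have "cis (1 / 2 * pi) = \<i>" by (simp add: complex_eq_iff)
  moreover have "cis (3 / 2 * pi) = - \<i>"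
    by (rule complex_eqI)
      (simp_all only: cis.sel cos_3over2_pi sin_3over2_pi uminus_complex.sel imaginary_unit.sel minus_zero)
  moreover have "Im (of_real c / cis (1 / 2 * pi)) \<le> 0" "Im (of_real c / cis (3 / 2 * pi)) \<le> 0"
    using p(2) by (intro half; simp)+
  ultimately have "Im (of_real c / \<i>) \<le> 0" "Im (of_real c / - \<i>) \<le> 0" by (simp_all only:)
  then have "c = 0" by simp
  then show False using nz by (simp add: c_def)
qed

text \<open>Orders at real points decide divisibility because \<open>q\<close> splits into real
  linear factors. The induction strips a common factor \<open>[:- a, 1:]\<close> from
  \<open>q\<close> and \<open>f\<close>.\<close>

lemma dvd_if_order_le:
  fixes q f :: "real poly"
  assumes "q \<noteq> 0" "f \<noteq> 0" "\<And>z::complex. rpoly q z = 0 \<Longrightarrow> z \<in> \<real>"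
    and "\<And>a. Polynomial.order a q \<le> Polynomial.order a f"
  shows "q dvd f"
  using assms
proof (induction "degree q" arbitrary: q f)
  case 0
  then have "is_unit q" by (simp add: is_unit_iff_degree)
  then show ?case by (rule unit_imp_dvd)
next
  case (Suc d)
  have "degree (map_poly complex_of_real q) \<noteq> 0" using Suc.hyps(2) by simp
  then have "\<not> constant (poly (map_poly complex_of_real q))" by (simp add: constant_degree)
  then obtain z where z: "rpoly q z = (0::complex)" using fundamental_theorem_of_algebra by blast
  then obtain a where "z = of_real a" using Suc.prems(3) by (auto elim: Reals_cases)
  then have a: "poly q a = 0" using z by (simp add: rpoly_of_real)
  then have "Polynomial.order a q \<noteq> 0" using Suc.prems(1) order_root by blast
  then have "Polynomial.order a f \<noteq> 0" using Suc.prems(4)[of a] by linarith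
  then have "poly f a = 0" using order_root by blast
  then obtain f' where f': "f = [:- a, 1:] * f'" by (auto simp: poly_eq_0_iff_dvd elim: dvdE)
  obtain q' where q': "q = [:- a, 1:] * q'" using a by (auto simp: poly_eq_0_iff_dvd elim: dvdE)
  have nz: "q' \<noteq> 0" "f' \<noteq> 0" using q' f' Suc.prems by auto
  have "q' dvd f'"
  proof (rule Suc.hyps(1))
    have "degree q = degree [:- a, 1:] + degree q'"
      unfolding q' using nz by (intro degree_mult_eq) auto
    then show "d = degree q'" using Suc.hyps(2) by simp
    show "z \<in> \<real>" if "rpoly q' z = 0" for z :: complex
    proof (rule Suc.prems(3))
      interpret comm_ring_hom "\<lambda>p. rpoly p z" by (rule comm_ring_hom_rpoly)
      show "rpoly q z = 0" unfolding q' hom_mult that by simp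
    qed
    show "Polynomial.order b q' \<le> Polynomial.order b f'" for b
    proof -
      have "Polynomial.order b q = Polynomial.order b [:- a, 1:] + Polynomial.order b q'"
        unfolding q' by (rule order_mult) (use Suc.prems(1) q' in simp)
      moreover have "Polynomial.order b f = Polynomial.order b [:- a, 1:] + Polynomial.order b f'"
        unfolding f' by (rule order_mult) (use Suc.prems(2) f' in simp)
      ultimately show ?thesis using Suc.prems(4)[of b] by linarith
    qed
  qed (use nz in auto)
  then show ?case unfolding q' f' by (rule mult_dvd_mono[OF dvd_refl])
qed

text \<open>The product of distinct linear factors adds one to the order at each root, which makes
  up for a pole of order at most one. This form of "all poles are simple" tolerates multiple roots
  of \<open>q\<close>, common zeros with \<open>g\<close>, and \<open>g = 0\<close>.\<close>

lemma dvd_distinct_roots_mult: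
  fixes q g :: "real poly"
  assumes "q \<noteq> 0" and real: "\<And>z::complex. rpoly q z = 0 \<Longrightarrow> z \<in> \<real>"
    and Im: "\<And>z. 0 < Im z \<Longrightarrow> Im (rpoly g z / rpoly q z) \<le> 0"
  shows "q dvd (\<Prod>a | poly q a = 0. [:- a, 1:]) * g"
proof (cases "g = 0")
  case False
  let ?R = "{a. poly q a = 0}" and ?r = "\<Prod>a | poly q a = 0. [:- a, 1:]"
  have fin: "finite ?R" using \<open>q \<noteq> 0\<close> by (rule poly_roots_finite)
  have "?r \<noteq> 0" using fin by simp
  show ?thesis
  proof (rule dvd_if_order_le)
    show "?r * g \<noteq> 0" using False \<open>?r \<noteq> 0\<close> by (metis mult_eq_0_iff)
    then have ord: "Polynomial.order a (?r * g) = Polynomial.order a ?r + Polynomial.order a g" for a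
      by (rule order_mult)
    show "Polynomial.order a q \<le> Polynomial.order a (?r * g)" for a
    proof (cases "poly q a = 0")
      case True
      have "poly ?r a = 0" using fin True by (auto simp: poly_prod)
      then have "1 \<le> Polynomial.order a ?r" using \<open>?r \<noteq> 0\<close> order_root by (metis less_one linorder_not_less)
      then show ?thesis using order_le_Suc_order[OF \<open>q \<noteq> 0\<close> False Im, of a] unfolding ord by linarith
    next
      case False
      then show ?thesis by (simp add: order_0I)
    qed
  qed (use assms in auto)
qed simp

text \<open>Lagrange interpolation at the nodes \<open>R\<close> reproduces \<open>K\<close> exactly
  because of its degree; division by the node polynomial gives the partial fractions.\<close>

lemma lagrange_partial_fractions:
  fixes K :: "real poly" and z :: complex
  assumes fin: "finite R" and deg: "degree K < card R" and z: "z \<notin> of_real ` R"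
  shows "rpoly K z / (\<Prod>a\<in>R. z - of_real a)
    = (\<Sum>a\<in>R. of_real (poly K a / (\<Prod>b\<in>R - {a}. a - b)) / (z - of_real a))"
proof -
  let ?D = "\<lambda>a. \<Prod>b\<in>R - {a}. a - b"
  let ?L = "\<Sum>a\<in>R. Polynomial.smult (poly K a / ?D a) (\<Prod>b\<in>R - {a}. [:- b, 1:])"
  have "K = ?L"
  proof (rule poly_eqI_degree)
    fix x assume x: "x \<in> R"
    have "poly ?L x = (\<Sum>a\<in>R. poly K a / ?D a * (\<Prod>b\<in>R - {a}. x - b))"
      by (simp add: poly_sum poly_prod)
    also have "\<dots> = (\<Sum>a\<in>R. if a = x then poly K x else 0)"
    proof (rule sum.cong[OF refl])
      fix a assume a: "a \<in> R"
      show "poly K a / ?D a * (\<Prod>b\<in>R - {a}. x - b) = (if a = x then poly K x else 0)"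
      proof (cases "a = x")
        case True
        have "?D x \<noteq> 0" using fin by auto
        then show ?thesis using True by simp
      next
        case False
        then have "(\<Prod>b\<in>R - {a}. x - b) = 0" using fin x by auto
        then show ?thesis using False by simp
      qed
    qed
    also have "\<dots> = poly K x" using fin x by simp
    finally show "poly K x = poly ?L x" ..
  next
    have card: "0 < card R" using deg by simp
    have "degree ?L \<le> card R - 1"
    proof (rule degree_sum_le[OF fin])
      fix a assume "a \<in> R"
      have "degree (\<Prod>b\<in>R - {a}. [:- b, 1:]) \<le> (\<Sum>b\<in>R - {a}. degree [:- b, 1:])"
        using degree_prod_sum_le[of "R - {a}" "\<lambda>b. [:- b, 1:]"] fin by (simp add: o_def)
      also have "\<dots> = card R - 1" using fin \<open>a \<in> R\<close> by simp
      finally show "degree (Polynomial.smult (poly K a / ?D a) (\<Prod>b\<in>R - {a}. [:- b, 1:])) \<le> card R - 1"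
        using degree_smult_le order.trans by blast
    qed
    then show "degree ?L < card R" using card by linarith
  qed (rule deg)
  then have "rpoly K z = rpoly ?L z" by simp
  also have "\<dots> = (\<Sum>a\<in>R. of_real (poly K a / ?D a) * (\<Prod>b\<in>R - {a}. z - of_real b))"
  proof -
    interpret comm_ring_hom "\<lambda>p. rpoly p z" by (rule comm_ring_hom_rpoly)
    have "rpoly [:- b, 1:] z = z - of_real b" for b
      by (simp add: of_real_hom.map_poly_pCons_hom)
    then show ?thesis by (simp only: hom_sum hom_prod rpoly_smult)
  qed
  finally have "rpoly K z / (\<Prod>a\<in>R. z - of_real a)
     = (\<Sum>a\<in>R. of_real (poly K a / ?D a) * (\<Prod>b\<in>R - {a}. z - of_real b) / (\<Prod>a\<in>R. z - of_real a))"
    by (simp only: sum_divide_distrib)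
  also have "\<dots> = (\<Sum>a\<in>R. of_real (poly K a / ?D a) / (z - of_real a))"
  proof (rule sum.cong[OF refl])
    fix a assume a: "a \<in> R"
    have "(\<Prod>b\<in>R - {a}. z - of_real b) \<noteq> 0" using z fin by auto
    moreover have "(\<Prod>b\<in>R. z - of_real b) = (z - of_real a) * (\<Prod>b\<in>R - {a}. z - of_real b)"
      using fin a by (rule prod.remove)
    ultimately show "of_real (poly K a / ?D a) * (\<Prod>b\<in>R - {a}. z - of_real b) / (\<Prod>a\<in>R. z - of_real a)
      = of_real (poly K a / ?D a) / (z - of_real a)" by simp
  qed
  finally show ?thesis .
qed

text \<open>Writing the divisibility as \<open>r * g = q * K\<close> turns \<open>g / q\<close> into
  \<open>K / r\<close>, whose denominator has only simple roots. Comparing degrees,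
  \<open>degree g < degree q\<close> becomes \<open>degree K < card R\<close>.\<close>

lemma partial_fractions_simple_poles:
  fixes q g :: "real poly"
  assumes dvd: "q dvd (\<Prod>a | poly q a = 0. [:- a, 1:]) * g" and deg: "degree g < degree q"
  shows "\<exists>w. \<forall>z::complex. rpoly q z \<noteq> 0 \<longrightarrow>
    rpoly g z / rpoly q z = (\<Sum>a | poly q a = 0. of_real (w a) / (z - of_real a))"
proof (cases "g = 0")
  case True
  then show ?thesis by (intro exI[of _ "\<lambda>_. 0"]) simp
next
  case False
  let ?R = "{a. poly q a = 0}" and ?r = "\<Prod>a | poly q a = 0. [:- a, 1:]"
  have "q \<noteq> 0" using deg by auto
  then have fin: "finite ?R" by (rule poly_roots_finite)
  have "?r \<noteq> 0" using fin by simp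
  obtain K where K: "?r * g = q * K" using dvd by (elim dvdE)
  then have "K \<noteq> 0" using False \<open>?r \<noteq> 0\<close> by (metis mult_eq_0_iff)
  have "degree ?r = card ?R"
    using fin by (subst degree_prod_eq_sum_degree) auto
  then have "card ?R + degree g = degree q + degree K"
    using arg_cong[OF K, of degree] False \<open>?r \<noteq> 0\<close> \<open>q \<noteq> 0\<close> \<open>K \<noteq> 0\<close> by (simp add: degree_mult_eq)
  then have "degree K < card ?R" using deg by linarith
  note pf = lagrange_partial_fractions[OF fin this]
  show ?thesis
  proof (intro exI[of _ "\<lambda>a. poly K a / (\<Prod>b\<in>?R - {a}. a - b)"] allI impI)
    fix z :: complex assume z: "rpoly q z \<noteq> 0"
    interpret comm_ring_hom "\<lambda>p. rpoly p z" by (rule comm_ring_hom_rpoly)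
    have "z \<notin> of_real ` ?R" using z by (auto simp: rpoly_of_real)
    have "rpoly [:- b, 1:] z = z - of_real b" for b
      by (simp add: of_real_hom.map_poly_pCons_hom)
    then have r: "rpoly ?r z = (\<Prod>a\<in>?R. z - of_real a)" by (simp only: hom_prod)
    have "(\<Prod>a\<in>?R. z - of_real a) \<noteq> 0" using \<open>z \<notin> of_real ` ?R\<close> fin by auto
    moreover have "(\<Prod>a\<in>?R. z - of_real a) * rpoly g z = rpoly q z * rpoly K z"
      unfolding r[symmetric] hom_mult[symmetric] K ..
    ultimately have "rpoly g z / rpoly q z = rpoly K z / (\<Prod>a\<in>?R. z - of_real a)"
      using z by (simp add: field_simps)
    then show "rpoly g z / rpoly q z
      = (\<Sum>a | poly q a = 0. of_real (poly K a / (\<Prod>b\<in>?R - {a}. a - b)) / (z - of_real a))"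
      using pf[OF \<open>z \<notin> of_real ` ?R\<close>] by simp
  qed
qed

text \<open>At \<open>z = a + iy\<close> with \<open>y\<close> decreasing to 0, the sum multiplied
  by \<open>iy\<close> tends to \<open>w a\<close>, and its real part is \<open>- y\<close> times a
  nonpositive imaginary part.\<close>

lemma residue_nonneg:
  assumes fin: "finite R" and a: "a \<in> R"
    and Im: "\<And>z. 0 < Im z \<Longrightarrow> Im (\<Sum>b\<in>R. of_real (w b) / (z - of_real b)) \<le> 0"
  shows "0 \<le> (w a :: real)"
proof -
  let ?z = "\<lambda>y. of_real a + \<i> * of_real y :: complex"
  \<comment> \<open>For \<open>0 < y\<close> this is \<open>iy\<close> times the sum, with the pole
    at \<open>a\<close> already cancelled so that the expression is continuous at
    \<open>y = 0\<close>.\<close>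
  let ?f = "\<lambda>y::real. of_real (w a) + (\<Sum>b\<in>R - {a}. \<i> * of_real y * of_real (w b) / (?z y - of_real b))"
  have f: "?f y = \<i> * of_real y * (\<Sum>b\<in>R. of_real (w b) / (?z y - of_real b))" if "0 < y" for y
    using that by (simp add: sum.remove[OF fin a] distrib_left sum_distrib_left)
  have "0 \<le> Re (?f y)" if y: "0 < y" for y
  proof -
    have "Re (?f y) = - y * Im (\<Sum>b\<in>R. of_real (w b) / (?z y - of_real b))"
      unfolding f[OF y] by simp
    also have "\<dots> \<ge> 0" using Im[of "?z y"] y by (simp add: mult_nonneg_nonpos)
    finally show ?thesis .
  qed
  then have ev: "eventually (\<lambda>y. 0 \<le> Re (?f y)) (at_right 0)"
    by (simp add: eventually_at_right_less eventually_at_filter)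
  have "((\<lambda>y. Re (?f y)) \<longlongrightarrow> Re (of_real (w a) + (\<Sum>b\<in>R - {a}. \<i> * of_real 0 * of_real (w b) / (?z 0 - of_real b)))) (at_right 0)"
    by (intro tendsto_intros) auto
  then have "((\<lambda>y. Re (?f y)) \<longlongrightarrow> w a) (at_right 0)" by simp
  then show ?thesis by (rule tendsto_lowerbound[OF _ ev]) simp
qed

subsection \<open>Adjugates and moments\<close>

lemma adj_mat_symmetric:
  assumes B: "B \<in> carrier_mat n n" and sym: "transpose_mat B = B" and ij: "i < n" "j < n"
  shows "adj_mat B $$ (i, j) = adj_mat B $$ (j, i)"
proof -
  have B_sym: "B $$ (k, l) = B $$ (l, k)" if "k < n" "l < n" for k l
    using that B sym by (metis carrier_matD index_transpose_mat(1))
  have "mat_delete B j i = transpose_mat (mat_delete B i j)"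
    using B ij by (intro eq_matI) (auto simp: mat_delete_def B_sym)
  moreover have "mat_delete B i j \<in> carrier_mat (n - 1) (n - 1)"
    using B by (auto simp: mat_delete_def)
  ultimately have "Determinant.det (mat_delete B j i) = Determinant.det (mat_delete B i j)"
    by (simp add: Determinant.det_transpose)
  then show ?thesis using B ij by (simp add: adj_mat_def cofactor_def add.commute)
qed

lemma degree_adj_mat_char_poly_matrix:
  assumes M: "M \<in> carrier_mat n n" and ij: "i < n" "j < n"
  shows "degree (adj_mat (char_poly_matrix M) $$ (i, j)) < n"
proof -
  note C = char_poly_matrix_closed[OF M]
  let ?D = "mat_delete (char_poly_matrix M) j i"
  have deg: "degree (char_poly_matrix M $$ (k, l)) \<le> 1" if "k < n" "l < n" for k l
    unfolding char_poly_matrix_index[OF M that] by simp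
  have "degree (Determinant.det ?D) \<le> 1 * (n - 1)"
  proof (rule degree_det_le)
    show "?D \<in> carrier_mat (n - 1) (n - 1)" using C by (auto simp: mat_delete_def)
    show "degree (?D $$ (k, l)) \<le> 1" if "k < n - 1" "l < n - 1" for k l
      using that C ij by (auto simp: mat_delete_def intro!: deg[unfolded One_nat_def])
  qed
  moreover have "degree (adj_mat (char_poly_matrix M) $$ (i, j)) = degree (Determinant.det ?D)"
    using C ij by (simp add: adj_mat_def cofactor_def minus_one_power_iff)
  ultimately show ?thesis using ij by simp
qed

text \<open>The identity \<open>(xI - M) adj(xI - M) = det(xI - M) I\<close>, solved for
  \<open>x adj(xI - M)\<close>. It is the recursion behind the expansion at infinity.\<close>

lemma pCons_0_adj_mat_char_poly_matrix:
  fixes M :: "'a::comm_ring_1 mat"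
  assumes M: "M \<in> carrier_mat n n" and ij: "i < n" "j < n"
  shows "[:0, 1:] * adj_mat (char_poly_matrix M) $$ (i, j)
    = (if i = j then char_poly M else 0)
      + (\<Sum>k<n. Polynomial.smult (M $$ (i, k)) (adj_mat (char_poly_matrix M) $$ (k, j)))"
proof -
  note C = char_poly_matrix_closed[OF M]
  note adj = adj_mat[OF C]
  let ?J = "\<lambda>k. adj_mat (char_poly_matrix M) $$ (k, j)"
  have "(if i = j then char_poly M else 0) = (char_poly_matrix M * adj_mat (char_poly_matrix M)) $$ (i, j)"
    unfolding adj(2) char_poly_def[symmetric] using ij by simp
  also have "\<dots> = (\<Sum>k<n. char_poly_matrix M $$ (i, k) * ?J k)"
    using C adj(1) ij by (simp add: scalar_prod_def atLeast0LessThan)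
  also have "\<dots> = (\<Sum>k<n. (if i = k then [:0, 1:] * ?J k else 0) - Polynomial.smult (M $$ (i, k)) (?J k))"
    using ij by (intro sum.cong) (auto simp: char_poly_matrix_index[OF M] algebra_simps)
  also have "\<dots> = [:0, 1:] * ?J i - (\<Sum>k<n. Polynomial.smult (M $$ (i, k)) (?J k))"
    unfolding sum_subtractf using ij by (simp add: sum.delta)
  finally show ?thesis by (simp add: algebra_simps)
qed

text \<open>A permutation other than the identity moves at least two points, so it contributes at most
  \<open>n - 2\<close> diagonal factors.\<close>

lemma coeff_char_poly_zero_diagonal:
  fixes M :: "'a::comm_ring_1 mat"
  assumes M: "M \<in> carrier_mat n n" and diag: "\<And>i. i < n \<Longrightarrow> M $$ (i, i) = 0" and k: "n \<le> Suc k"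
  shows "Polynomial.coeff (char_poly M) k = (if k = n then 1 else 0)"
proof -
  note C = char_poly_matrix_closed[OF M]
  let ?f = "\<lambda>p. signof p * (\<Prod>i = 0..<n. char_poly_matrix M $$ (i, p i)) :: 'a poly"
  have "Polynomial.coeff (?f p) k = 0" if p: "p permutes {0..<n}" and "p \<noteq> id" for p
  proof -
    have deg: "degree (char_poly_matrix M $$ (i, p i)) \<le> (if p i = i then 1 else 0)" if "i < n" for i
    proof -
      have "p i < n" using permutes_in_image[OF p, of i] that by simp
      then show ?thesis using that by (simp add: char_poly_matrix_index[OF M])
    qed
    obtain i where pi: "p i \<noteq> i" using \<open>p \<noteq> id\<close> by (auto simp: fun_eq_iff)
    then have ppi: "p (p i) \<noteq> p i" using permutes_inj[OF p] by (auto dest: injD)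
    have mem: "i \<in> {0..<n}" "p i \<in> {0..<n}"
      using pi ppi permutes_not_in[OF p] by blast+
    have "degree (?f p) \<le> (\<Sum>i = 0..<n. degree (char_poly_matrix M $$ (i, p i)))"
      using degree_prod_sum_le[of "{0..<n}" "\<lambda>i. char_poly_matrix M $$ (i, p i)"] by (simp add: o_def)
    also have "\<dots> \<le> (\<Sum>i = 0..<n. if p i = i then 1 else 0)" by (intro sum_mono deg) simp
    also have "\<dots> = card {i \<in> {0..<n}. p i = i}" by (simp add: sum.If_cases Int_def)
    also have "\<dots> \<le> card ({0..<n} - {i, p i})" using pi ppi by (intro card_mono) auto
    also have "\<dots> = n - 2" using mem pi by (subst card_Diff_subset) auto
    \<comment> \<open>The distinct moved points \<open>i\<close> and \<open>p i\<close> force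
      \<open>n \<ge> 2\<close>, so the subtraction is not truncated and \<open>n - 2\<close> lies
      below \<open>k\<close>, which is at least \<open>n - 1\<close>.\<close>
    also have "\<dots> < k" using mem pi k by auto
    finally show ?thesis by (rule coeff_eq_0)
  qed
  then have "Polynomial.coeff (char_poly M) k = Polynomial.coeff (?f id) k"
    unfolding char_poly_def Determinant.det_def'[OF C] coeff_sum
    by (subst sum.remove[of _ id]) (auto simp: finite_permutations permutes_id intro!: sum.neutral)
  also have "?f id = (\<Prod>i = 0..<n. [:0, 1:])"
    unfolding id_def by (simp add: char_poly_matrix_index[OF M] diag)
  also have "\<dots> = monom 1 n" by (simp add: monom_altdef)
  finally show ?thesis by simp
qed

lemma poly_quotient_tendsto_0:
  fixes f q :: "real poly"
  assumes "degree f < degree q"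
  shows "((\<lambda>x. poly f x / poly q x) \<longlongrightarrow> 0) at_top"
  using poly_divide_tendsto_0_at_infinity[OF assms] at_top_le_at_infinity by (rule tendsto_mono[rotated])

text \<open>The total weight is the coefficient of \<open>1 / x\<close> at infinity. Applied to the
  weights \<open>a ^ m * w a\<close>, this reads off the moment of order \<open>m\<close>.\<close>

lemma partial_fractions_tendsto:
  fixes v :: "real \<Rightarrow> real"
  shows "((\<lambda>x. x * (\<Sum>a\<in>R. v a / (x - a))) \<longlongrightarrow> (\<Sum>a\<in>R. v a)) at_top"
proof -
  have "((\<lambda>x. x * (v a / (x - a))) \<longlongrightarrow> v a) at_top" for a
  proof -
    have "filterlim (\<lambda>x::real. - a + x) at_top at_top"
      by (rule filterlim_tendsto_add_at_top[OF tendsto_const filterlim_ident])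
    then have "((\<lambda>x. inverse (- a + x)) \<longlongrightarrow> 0) at_top" by (rule tendsto_inverse_0_at_top)
    then have "((\<lambda>x. v a + a * v a * inverse (- a + x)) \<longlongrightarrow> v a + a * v a * 0) at_top"
      by (intro tendsto_intros)
    then have lim: "((\<lambda>x. v a + a * v a * inverse (- a + x)) \<longlongrightarrow> v a) at_top" by simp
    show ?thesis
    proof (rule Lim_transform_eventually[OF lim])
      show "eventually (\<lambda>x. v a + a * v a * inverse (- a + x) = x * (v a / (x - a))) at_top"
        using eventually_gt_at_top[of a] by eventually_elim (simp add: field_simps)
    qed
  qed
  then show ?thesis unfolding sum_distrib_left by (intro tendsto_sum)
qed

lemma sum_signs_mult:
  assumes "i < n" "j < n"
  shows "(\<Sum>\<epsilon>\<in>signs n. \<epsilon> i * \<epsilon> j) = (if i = j then 2 ^ n else 0)"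
  using sum_signs_prod_prod[of "{i}" n "{j}"] assms by simp

lemma average_cut_mat:
  assumes A: "A \<in> carrier_mat n n" and diag: "\<And>i. i < n \<Longrightarrow> A $$ (i, i) = 0" and ij: "i < n" "j < n"
  shows "(\<Sum>\<epsilon>\<in>signs n. cut_mat A \<epsilon> $$ (i, j)) / 2 ^ n = A $$ (i, j) / 2"
proof -
  have "(\<Sum>\<epsilon>\<in>signs n. cut_mat A \<epsilon> $$ (i, j)) = (2 ^ n - (\<Sum>\<epsilon>\<in>signs n. \<epsilon> i * \<epsilon> j)) / 2 * A $$ (i, j)"
    unfolding cut_mat_index[OF A ij] sum_distrib_right[symmetric] sum_divide_distrib[symmetric] sum_subtractf by simp
  then show ?thesis using diag ij by (simp add: sum_signs_mult)
qed

text \<open>For \<open>k\<close> different from \<open>i\<close> and \<open>j\<close>, the mean of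
  \<open>(1 - \<epsilon> i * \<epsilon> k) * (1 - \<epsilon> k * \<epsilon> j)\<close> is one plus
  the mean of \<open>\<epsilon> i * \<epsilon> j\<close>, that is 2 on the diagonal and 1 off it;
  the remaining \<open>k\<close> drop out by the zero diagonal. The doubling on the diagonal is the
  origin of \<open>diag_part\<close>.\<close>

lemma average_cut_mat_square:
  assumes A: "A \<in> carrier_mat n n" and diag: "\<And>i. i < n \<Longrightarrow> A $$ (i, i) = 0" and ij: "i < n" "j < n"
  shows "(\<Sum>\<epsilon>\<in>signs n. \<Sum>k<n. cut_mat A \<epsilon> $$ (i, k) * cut_mat A \<epsilon> $$ (k, j)) / 2 ^ n
    = (A * A + diag_part (A * A)) $$ (i, j) / 4"
proof -
  have k: "(\<Sum>\<epsilon>\<in>signs n. cut_mat A \<epsilon> $$ (i, k) * cut_mat A \<epsilon> $$ (k, j))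
      = 2 ^ n * (A $$ (i, k) * A $$ (k, j) * (if i = j then 2 else 1) / 4)" if "k < n" for k
  proof -
    have "(\<Sum>\<epsilon>\<in>signs n. cut_mat A \<epsilon> $$ (i, k) * cut_mat A \<epsilon> $$ (k, j))
      = (\<Sum>\<epsilon>\<in>signs n. (1 - \<epsilon> i * \<epsilon> k - \<epsilon> k * \<epsilon> j + \<epsilon> i * \<epsilon> j) * (A $$ (i, k) * A $$ (k, j) / 4))"
    proof (rule sum.cong[OF refl])
      fix \<epsilon> assume "\<epsilon> \<in> signs n"
      then have "\<epsilon> k * \<epsilon> k = 1" using that by (rule signs_square)
      moreover have "(1 - \<epsilon> i * \<epsilon> k) * (1 - \<epsilon> k * \<epsilon> j)
        = 1 - \<epsilon> i * \<epsilon> k - \<epsilon> k * \<epsilon> j + \<epsilon> i * \<epsilon> j * (\<epsilon> k * \<epsilon> k)"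
        by (simp add: algebra_simps)
      ultimately have prod: "(1 - \<epsilon> i * \<epsilon> k) * (1 - \<epsilon> k * \<epsilon> j) = 1 - \<epsilon> i * \<epsilon> k - \<epsilon> k * \<epsilon> j + \<epsilon> i * \<epsilon> j"
        by simp
      then show "cut_mat A \<epsilon> $$ (i, k) * cut_mat A \<epsilon> $$ (k, j)
        = (1 - \<epsilon> i * \<epsilon> k - \<epsilon> k * \<epsilon> j + \<epsilon> i * \<epsilon> j) * (A $$ (i, k) * A $$ (k, j) / 4)"
        using that ij by (simp add: cut_mat_index[OF A] flip: prod)
    qed
    also have "\<dots> = (2 ^ n - (\<Sum>\<epsilon>\<in>signs n. \<epsilon> i * \<epsilon> k) - (\<Sum>\<epsilon>\<in>signs n. \<epsilon> k * \<epsilon> j) + (\<Sum>\<epsilon>\<in>signs n. \<epsilon> i * \<epsilon> j))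
        * (A $$ (i, k) * A $$ (k, j) / 4)"
      unfolding sum_distrib_right[symmetric] sum.distrib sum_subtractf by simp
    also have "\<dots> = 2 ^ n * (A $$ (i, k) * A $$ (k, j) * (if i = j then 2 else 1) / 4)"
      using that ij diag by (auto simp: sum_signs_mult)
    finally show ?thesis .
  qed
  have e1: "(\<Sum>\<epsilon>\<in>signs n. \<Sum>k<n. cut_mat A \<epsilon> $$ (i, k) * cut_mat A \<epsilon> $$ (k, j)) / 2 ^ n
    = (\<Sum>k<n. A $$ (i, k) * A $$ (k, j)) * (if i = j then 2 else 1) / 4"
    by (subst sum.swap) (simp add: k sum_distrib_left[symmetric] sum_distrib_right[symmetric] sum_divide_distrib[symmetric])
  have e2: "(A * A) $$ (i, j) = (\<Sum>k<n. A $$ (i, k) * A $$ (k, j))"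
    using A ij by (simp add: scalar_prod_def atLeast0LessThan)
  have e3: "diag_part (A * A) $$ (i, j) = (if i = j then (A * A) $$ (i, j) else 0)"
    using A ij by (simp add: diag_part_def mat_diag_def)
  have e4: "(A * A + diag_part (A * A)) $$ (i, j) = (A * A) $$ (i, j) + diag_part (A * A) $$ (i, j)"
    using A ij by (intro index_add_mat) (simp_all add: diag_part_def mat_diag_def)
  show ?thesis unfolding e1 e4 e3 e2 by simp
qed

text \<open>These weighted averages of the \<open>j\<close>-th columns of the adjugates are closed under multiplication by
  \<open>x\<close>, up to multiples of characteristic polynomials. This generates the expansion of \<open>F\<close> at infinity.\<close>

definition weighted_G :: "real mat \<Rightarrow> ((nat \<Rightarrow> real) \<Rightarrow> nat \<Rightarrow> real) \<Rightarrow> nat \<Rightarrow> real poly" where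
  "weighted_G A c j = Polynomial.smult (1 / 2 ^ dim_row A) (\<Sum>\<epsilon>\<in>signs (dim_row A). \<Sum>k<dim_row A.
     Polynomial.smult (c \<epsilon> k) (adj_mat (char_poly_matrix (cut_mat A \<epsilon>)) $$ (k, j)))"

lemma degree_weighted_G:
  assumes A: "A \<in> carrier_mat n n" and j: "j < n"
  shows "degree (weighted_G A c j) < n"
proof -
  have "degree (weighted_G A c j) \<le> n - 1"
    unfolding weighted_G_def
  proof (intro order.trans[OF degree_smult_le] degree_sum_le)
    fix \<epsilon> k assume "k \<in> {..<dim_row A}"
    then have "degree (adj_mat (char_poly_matrix (cut_mat A \<epsilon>)) $$ (k, j)) < n"
      using A by (intro degree_adj_mat_char_poly_matrix[OF cut_mat_carrier[OF A] _ j]) simp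
    then show "degree (adj_mat (char_poly_matrix (cut_mat A \<epsilon>)) $$ (k, j)) \<le> n - 1" by simp
  qed simp_all
  then show ?thesis using j by linarith
qed

lemma G_poly_eq_weighted_G:
  assumes A: "A \<in> carrier_mat n n" and ij: "i < n" "j < n"
  shows "G_poly A i j = weighted_G A (\<lambda>_ k. if k = i then 1 else 0) j"
proof -
  have "(\<Sum>k<n. Polynomial.smult (if k = i then 1 else 0) (B $$ (k, j))) = (B $$ (i, j) :: real poly)" for B
    using ij by (simp add: if_distrib[of "\<lambda>c. Polynomial.smult c _"] cong: if_cong)
  then show ?thesis using A by (simp add: G_poly_def weighted_G_def)
qed

text \<open>Multiplication by \<open>x\<close> replaces the weight row \<open>c \<epsilon>\<close>
  by its product with \<open>cut_mat A \<epsilon>\<close>, so that, starting from a unit row, the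
  weights run through the rows of the powers of the cut matrix.\<close>

lemma weighted_G_step:
  assumes A: "A \<in> carrier_mat n n" and j: "j < n"
  shows "x * poly (weighted_G A c j) x
    = (\<Sum>\<epsilon>\<in>signs n. c \<epsilon> j * poly (char_poly (cut_mat A \<epsilon>)) x) / 2 ^ n
      + poly (weighted_G A (\<lambda>\<epsilon> l. \<Sum>k<n. c \<epsilon> k * cut_mat A \<epsilon> $$ (k, l)) j) x"
proof -
  let ?J = "\<lambda>\<epsilon> k. poly (adj_mat (char_poly_matrix (cut_mat A \<epsilon>)) $$ (k, j)) x"
  let ?p = "\<lambda>\<epsilon>. poly (char_poly (cut_mat A \<epsilon>)) x"
  have step: "x * ?J \<epsilon> k = (if k = j then ?p \<epsilon> else 0) + (\<Sum>l<n. cut_mat A \<epsilon> $$ (k, l) * ?J \<epsilon> l)" if "k < n" for \<epsilon> k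
    using arg_cong[OF pCons_0_adj_mat_char_poly_matrix[OF cut_mat_carrier[OF A] that j], of "\<lambda>p. poly p x" \<epsilon>]
    by (simp add: poly_sum split: if_splits)
  have "x * (\<Sum>k<n. c \<epsilon> k * ?J \<epsilon> k) = c \<epsilon> j * ?p \<epsilon> + (\<Sum>l<n. (\<Sum>k<n. c \<epsilon> k * cut_mat A \<epsilon> $$ (k, l)) * ?J \<epsilon> l)" for \<epsilon>
  proof -
    have "x * (\<Sum>k<n. c \<epsilon> k * ?J \<epsilon> k) = (\<Sum>k<n. c \<epsilon> k * (x * ?J \<epsilon> k))"
      by (simp add: sum_distrib_left mult_ac)
    also have "\<dots> = (\<Sum>k<n. (if k = j then c \<epsilon> j * ?p \<epsilon> else 0) + (\<Sum>l<n. c \<epsilon> k * cut_mat A \<epsilon> $$ (k, l) * ?J \<epsilon> l))"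
      by (intro sum.cong refl) (simp add: step distrib_left sum_distrib_left mult.assoc)
    also have "\<dots> = c \<epsilon> j * ?p \<epsilon> + (\<Sum>k<n. \<Sum>l<n. c \<epsilon> k * cut_mat A \<epsilon> $$ (k, l) * ?J \<epsilon> l)"
      unfolding sum.distrib using j by simp
    also have "(\<Sum>k<n. \<Sum>l<n. c \<epsilon> k * cut_mat A \<epsilon> $$ (k, l) * ?J \<epsilon> l) = (\<Sum>l<n. (\<Sum>k<n. c \<epsilon> k * cut_mat A \<epsilon> $$ (k, l)) * ?J \<epsilon> l)"
      by (subst sum.swap) (simp add: sum_distrib_right)
    finally show ?thesis .
  qed
  note eps = this
  have "x * poly (weighted_G A c j) x = (\<Sum>\<epsilon>\<in>signs n. x * (\<Sum>k<n. c \<epsilon> k * ?J \<epsilon> k)) / 2 ^ n"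
    using A by (simp add: weighted_G_def poly_sum sum_distrib_left sum_divide_distrib)
  also have "\<dots> = (\<Sum>\<epsilon>\<in>signs n. c \<epsilon> j * ?p \<epsilon>) / 2 ^ n
    + (\<Sum>\<epsilon>\<in>signs n. \<Sum>l<n. (\<Sum>k<n. c \<epsilon> k * cut_mat A \<epsilon> $$ (k, l)) * ?J \<epsilon> l) / 2 ^ n"
    unfolding eps by (simp add: sum.distrib add_divide_distrib)
  finally show ?thesis using A by (simp add: weighted_G_def poly_sum)
qed

text \<open>Negating \<open>x\<close> turns the matrices \<open>xI - A\<close> and
  \<open>xI + A\<close> into the negatives of each other. Exchanging \<open>S\<close> with its
  complement restores the sum, and the signs from the two minors combine to
  \<open>(-1) ^ n\<close>.\<close>

lemma poly_q_poly_uminus: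
  fixes x :: real
  assumes A: "A \<in> carrier_mat n n"
  shows "poly (q_poly A) (- x) = (-1) ^ n * poly (q_poly A) x"
proof -
  let ?N = "{..<n}"
  let ?P = "\<lambda>i j. (if i = j then x else 0) - A $$ (i, j)"
  let ?Q = "\<lambda>i j. (if i = j then x else 0) + A $$ (i, j)"
  have neg: "principal_minor (\<lambda>i j. - R i j) S = (-1) ^ card S * principal_minor R S" for R :: "nat \<Rightarrow> nat \<Rightarrow> real" and S
    by (simp add: principal_minor_def prod_uminus sum_distrib_left mult_ac)
  have "poly (q_poly A) (- x) * 2 ^ n = (\<Sum>S\<in>Pow ?N. principal_minor (\<lambda>i j. - ?Q i j) S * principal_minor (\<lambda>i j. - ?P i j) (?N - S))"
    using rpoly_q_poly[OF A, of "- x"] by (auto intro!: sum.cong arg_cong2[of _ _ _ _ "(*)"] principal_minor_cong)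
  also have "\<dots> = (\<Sum>S\<in>Pow ?N. (-1) ^ n * (principal_minor ?P (?N - S) * principal_minor ?Q S))"
  proof (rule sum.cong[OF refl])
    fix S assume "S \<in> Pow ?N"
    then have "S \<subseteq> ?N" by simp
    then have "card S + card (?N - S) = n"
      by (metis card_Diff_subset card_lessThan card_mono finite_lessThan finite_subset le_add_diff_inverse)
    then have "(-1::real) ^ n = (-1) ^ card S * (-1) ^ card (?N - S)" by (metis power_add)
    then show "principal_minor (\<lambda>i j. - ?Q i j) S * principal_minor (\<lambda>i j. - ?P i j) (?N - S)
      = (-1) ^ n * (principal_minor ?P (?N - S) * principal_minor ?Q S)"
      unfolding neg by (simp only: mult_ac)
  qed
  also have "\<dots> = (\<Sum>S\<in>Pow ?N. (-1) ^ n * (principal_minor ?P S * principal_minor ?Q (?N - S)))"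
    by (rule sum.reindex_bij_witness[of _ "\<lambda>S. ?N - S" "\<lambda>S. ?N - S"]) (auto simp: double_diff)
  also have "\<dots> = (-1) ^ n * poly (q_poly A) x * 2 ^ n"
    using rpoly_q_poly[OF A, of x] by (simp add: sum_distrib_left)
  finally show ?thesis by simp
qed

lemma eventually_not_in_finite:
  assumes "finite (R :: real set)"
  shows "eventually (\<lambda>x. x \<notin> R) at_top"
proof -
  have "eventually (\<lambda>x. \<forall>a\<in>R. a < x) at_top"
    using assms by (intro eventually_ball_finite ballI eventually_gt_at_top)
  then show ?thesis by eventually_elim auto
qed

text \<open>Removing the value at infinity after multiplication by \<open>x\<close> raises the order
  of the moment by one.\<close>

lemma partial_fractions_shift:
  fixes v :: "real \<Rightarrow> real"
  assumes "x \<notin> R"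
  shows "x * (\<Sum>a\<in>R. v a / (x - a)) - (\<Sum>a\<in>R. v a) = (\<Sum>a\<in>R. a * v a / (x - a))"
  unfolding sum_distrib_left sum_subtractf[symmetric]
proof (rule sum.cong[OF refl])
  fix a assume "a \<in> R"
  then have "x - a \<noteq> 0" using assms by auto
  then show "x * (v a / (x - a)) - v a = a * v a / (x - a)" by (simp add: field_simps)
qed

text \<open>Cut matrices inherit the zero diagonal, so their characteristic polynomials, and hence
  also the mean \<open>q_poly A\<close>, have the same coefficients from degree \<open>n - 1\<close>
  on. The gap leaves room for one factor \<open>x\<close>.\<close>

lemma char_poly_cut_mat_close_q_poly:
  assumes A: "A \<in> carrier_mat n n" and diag: "\<And>i. i < n \<Longrightarrow> A $$ (i, i) = 0" and n: "0 < n"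
  shows "degree ([:0, 1:] * (char_poly (cut_mat A \<epsilon>) - q_poly A)) < n"
proof -
  have c: "Polynomial.coeff (char_poly (cut_mat A \<epsilon>)) k = (if k = n then 1 else 0)" if "n \<le> Suc k" for k \<epsilon>
    using that diag by (intro coeff_char_poly_zero_diagonal[OF cut_mat_carrier[OF A]]) (simp_all add: cut_mat_index[OF A])
  have "Polynomial.coeff (char_poly (cut_mat A \<epsilon>) - q_poly A) k = 0" if "n \<le> Suc k" for k
    using that by (simp add: c q_poly_eq_average[OF A] coeff_sum)
  then have "Polynomial.coeff ([:0, 1:] * (char_poly (cut_mat A \<epsilon>) - q_poly A)) k = 0" if "n \<le> k" for k
    using that n by (cases k) simp_all
  then have "degree ([:0, 1:] * (char_poly (cut_mat A \<epsilon>) - q_poly A)) \<le> n - 1"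
    using n by (intro degree_le) auto
  then show ?thesis using n by linarith
qed

text \<open>Both sides of the partial fraction identity are expanded at infinity: the left side by
  \<open>weighted_G_step\<close>, the right side by \<open>partial_fractions_shift\<close>. In each
  round the limit of \<open>x\<close> times the current remainder is the next moment.\<close>

lemma moments_of_partial_fractions:
  assumes A: "A \<in> carrier_mat n n" and diag: "\<And>i. i < n \<Longrightarrow> A $$ (i, i) = 0" and ij: "i < n" "j < n"
    and pf: "\<And>x. poly (q_poly A) x \<noteq> 0 \<Longrightarrow>
      poly (G_poly A i j) x / poly (q_poly A) x = (\<Sum>a\<in>q_roots A. w a / (x - a))"
  shows "(\<Sum>a\<in>q_roots A. w a) = (if i = j then 1 else 0)" (is ?H0)
    and "(\<Sum>a\<in>q_roots A. a * w a) = A $$ (i, j) / 2" (is ?H1)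
    and "(\<Sum>a\<in>q_roots A. a\<^sup>2 * w a) = (A * A + diag_part (A * A)) $$ (i, j) / 4" (is ?H2)
proof -
  let ?R = "q_roots A" and ?q = "poly (q_poly A)"
  let ?p = "\<lambda>\<epsilon>. poly (char_poly (cut_mat A \<epsilon>))"
  have "q_poly A \<noteq> 0" using q_poly_monic[OF A] by auto
  then have fin: "finite ?R" unfolding q_roots_def by (rule poly_roots_finite)
  have ev: "eventually (\<lambda>x. x \<notin> ?R) at_top" using fin by (rule eventually_not_in_finite)
  \<comment> \<open>\<open>?c0\<close> to \<open>?c3\<close> are the rows \<open>i\<close> of the
    powers 0 to 3 of \<open>cut_mat A \<epsilon>\<close>.\<close>
  let ?c0 = "\<lambda>\<epsilon> k. if k = i then 1 else 0 :: real"
  let ?c1 = "\<lambda>\<epsilon> k. cut_mat A \<epsilon> $$ (i, k)"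
  let ?c2 = "\<lambda>\<epsilon> l. \<Sum>k<n. cut_mat A \<epsilon> $$ (i, k) * cut_mat A \<epsilon> $$ (k, l)"
  let ?c3 = "\<lambda>\<epsilon> l. \<Sum>k<n. ?c2 \<epsilon> k * cut_mat A \<epsilon> $$ (k, l)"
  have L: "((\<lambda>x. poly (weighted_G A c j) x / ?q x) \<longlongrightarrow> 0) at_top" for c
    by (rule poly_quotient_tendsto_0) (simp add: degree_weighted_G[OF A ij(2)] q_poly_monic[OF A])
  have close: "((\<lambda>x. x * (?p \<epsilon> x - ?q x) / ?q x) \<longlongrightarrow> 0) at_top" for \<epsilon>
    using poly_quotient_tendsto_0[of "[:0, 1:] * (char_poly (cut_mat A \<epsilon>) - q_poly A)" "q_poly A"]
      char_poly_cut_mat_close_q_poly[OF A diag, of \<epsilon>] ij q_poly_monic[OF A] by simp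
  have ratio: "((\<lambda>x. ?p \<epsilon> x / ?q x) \<longlongrightarrow> 1) at_top" for \<epsilon>
  proof -
    have "((\<lambda>x. inverse x * (x * (?p \<epsilon> x - ?q x) / ?q x) + 1) \<longlongrightarrow> 0 * 0 + 1) at_top"
      by (intro tendsto_intros close tendsto_inverse_0_at_top filterlim_ident)
    then have lim: "((\<lambda>x. inverse x * (x * (?p \<epsilon> x - ?q x) / ?q x) + 1) \<longlongrightarrow> 1) at_top" by simp
    show ?thesis
    proof (rule Lim_transform_eventually[OF lim])
      show "eventually (\<lambda>x. inverse x * (x * (?p \<epsilon> x - ?q x) / ?q x) + 1 = ?p \<epsilon> x / ?q x) at_top"
        using ev eventually_gt_at_top[of 0] by eventually_elim (simp add: q_roots_def field_simps)
    qed
  qed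
  \<comment> \<open>In the first round the weights do not depend on \<open>\<epsilon>\<close>, so
    the characteristic polynomials average to \<open>q_poly A\<close> without an error term.\<close>
  have c0: "(\<Sum>\<epsilon>\<in>signs n. ?c0 \<epsilon> j * ?p \<epsilon> x) / 2 ^ n = (if i = j then ?q x else 0)" for x
    by (simp add: q_poly_eq_average[OF A] poly_sum)
  have c1: "(\<lambda>\<epsilon> l. \<Sum>k<n. ?c0 \<epsilon> k * cut_mat A \<epsilon> $$ (k, l)) = ?c1"
    using ij by (simp add: if_distrib[of "\<lambda>c. c * _"] cong: if_cong)
  note step0 = weighted_G_step[OF A ij(2), of _ ?c0, unfolded c0 c1]
  note step1 = weighted_G_step[OF A ij(2), of _ ?c1]
  note step2 = weighted_G_step[OF A ij(2), of _ ?c2]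
  have F0: "eventually (\<lambda>x. (\<Sum>a\<in>?R. w a / (x - a)) = poly (weighted_G A ?c0 j) x / ?q x) at_top"
    using ev by eventually_elim (simp add: pf[unfolded q_roots_def, symmetric] G_poly_eq_weighted_G[OF A ij] q_roots_def)
  have lim0: "((\<lambda>x. (if i = j then 1 else 0) + poly (weighted_G A ?c1 j) x / ?q x) \<longlongrightarrow> (if i = j then 1 else 0) + 0) at_top"
    by (intro tendsto_intros L)
  have "((\<lambda>x. x * (\<Sum>a\<in>?R. w a / (x - a))) \<longlongrightarrow> (if i = j then 1 else 0) + 0) at_top"
  proof (rule Lim_transform_eventually[OF lim0])
    show "eventually (\<lambda>x. (if i = j then 1 else 0) + poly (weighted_G A ?c1 j) x / ?q x = x * (\<Sum>a\<in>?R. w a / (x - a))) at_top"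
      using F0 ev by eventually_elim (simp add: step0 q_roots_def add_divide_distrib)
  qed
  then show H0: ?H0 using tendsto_unique[OF _ partial_fractions_tendsto] by fastforce
  have F1: "eventually (\<lambda>x. (\<Sum>a\<in>?R. a * w a / (x - a)) = poly (weighted_G A ?c1 j) x / ?q x) at_top"
    using F0 ev
  proof eventually_elim
    case (elim x)
    have q: "?q x \<noteq> 0" using elim by (simp add: q_roots_def)
    have "(\<Sum>a\<in>?R. a * w a / (x - a)) = x * (\<Sum>a\<in>?R. w a / (x - a)) - (if i = j then 1 else 0)"
      using partial_fractions_shift[OF elim(2), of w] H0 by simp
    also have "\<dots> = poly (weighted_G A ?c1 j) x / ?q x"
      unfolding elim(1) using q by (simp add: step0 add_divide_distrib)
    finally show ?case .
  qed
  let ?m1 = "(\<Sum>\<epsilon>\<in>signs n. ?c1 \<epsilon> j) / 2 ^ n" and ?m2 = "(\<Sum>\<epsilon>\<in>signs n. ?c2 \<epsilon> j) / 2 ^ n"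
  have lim1: "((\<lambda>x. (\<Sum>\<epsilon>\<in>signs n. ?c1 \<epsilon> j * (?p \<epsilon> x / ?q x)) / 2 ^ n + poly (weighted_G A ?c2 j) x / ?q x)
      \<longlongrightarrow> (\<Sum>\<epsilon>\<in>signs n. ?c1 \<epsilon> j * 1) / 2 ^ n + 0) at_top"
    by (intro tendsto_intros L ratio) simp
  have "((\<lambda>x. x * (\<Sum>a\<in>?R. a * w a / (x - a))) \<longlongrightarrow> (\<Sum>\<epsilon>\<in>signs n. ?c1 \<epsilon> j * 1) / 2 ^ n + 0) at_top"
  proof (rule Lim_transform_eventually[OF lim1])
    show "eventually (\<lambda>x. (\<Sum>\<epsilon>\<in>signs n. ?c1 \<epsilon> j * (?p \<epsilon> x / ?q x)) / 2 ^ n + poly (weighted_G A ?c2 j) x / ?q x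
       = x * (\<Sum>a\<in>?R. a * w a / (x - a))) at_top"
      using F1 by eventually_elim (simp add: step1 add_divide_distrib sum_divide_distrib mult.commute)
  qed
  then have H1: "(\<Sum>a\<in>?R. a * w a) = ?m1"
    using tendsto_unique[OF _ partial_fractions_tendsto[of "\<lambda>a. a * w a"]] by fastforce
  then show ?H1 using average_cut_mat[OF A diag ij] by simp
  \<comment> \<open>From here on the weights are correlated with the characteristic polynomials;
    subtracting the first moment leaves the error in the form \<open>(p - q) / q\<close>.\<close>
  have F2: "eventually (\<lambda>x. (\<Sum>a\<in>?R. a\<^sup>2 * w a / (x - a))
      = (\<Sum>\<epsilon>\<in>signs n. ?c1 \<epsilon> j * ((?p \<epsilon> x - ?q x) / ?q x)) / 2 ^ n + poly (weighted_G A ?c2 j) x / ?q x) at_top"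
    using F1 ev
  proof eventually_elim
    case (elim x)
    have q: "?q x \<noteq> 0" using elim by (simp add: q_roots_def)
    have "(\<Sum>a\<in>?R. a\<^sup>2 * w a / (x - a)) = x * (\<Sum>a\<in>?R. a * w a / (x - a)) - ?m1"
      using partial_fractions_shift[OF elim(2), of "\<lambda>a. a * w a"] by (simp add: H1 power2_eq_square mult.assoc)
    also have "\<dots> = (\<Sum>\<epsilon>\<in>signs n. ?c1 \<epsilon> j * ?p \<epsilon> x) / 2 ^ n / ?q x + poly (weighted_G A ?c2 j) x / ?q x - ?m1"
      unfolding elim(1) by (simp add: step1 add_divide_distrib)
    finally have e1: "(\<Sum>a\<in>?R. a\<^sup>2 * w a / (x - a)) = \<dots>" .
    have e2: "(\<Sum>\<epsilon>\<in>signs n. ?c1 \<epsilon> j * ((?p \<epsilon> x - ?q x) / ?q x))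
        = (\<Sum>\<epsilon>\<in>signs n. ?c1 \<epsilon> j * ?p \<epsilon> x) / ?q x - (\<Sum>\<epsilon>\<in>signs n. ?c1 \<epsilon> j)"
      unfolding sum_divide_distrib sum_subtractf[symmetric]
      by (rule sum.cong) (simp_all add: q diff_divide_distrib right_diff_distrib)
    show ?case unfolding e1 e2 by (simp add: diff_divide_distrib)
  qed
  \<comment> \<open>By \<open>close\<close> the error vanishes even after multiplication by
    \<open>x\<close>, so only the mean of the squared cut matrix remains.\<close>
  have lim2: "((\<lambda>x. (\<Sum>\<epsilon>\<in>signs n. ?c1 \<epsilon> j * (x * (?p \<epsilon> x - ?q x) / ?q x)) / 2 ^ n
        + ((\<Sum>\<epsilon>\<in>signs n. ?c2 \<epsilon> j * (?p \<epsilon> x / ?q x)) / 2 ^ n + poly (weighted_G A ?c3 j) x / ?q x))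
      \<longlongrightarrow> (\<Sum>\<epsilon>\<in>signs n. ?c1 \<epsilon> j * 0) / 2 ^ n + ((\<Sum>\<epsilon>\<in>signs n. ?c2 \<epsilon> j * 1) / 2 ^ n + 0)) at_top"
    by (intro tendsto_add[OF _ tendsto_add] tendsto_divide tendsto_sum tendsto_mult tendsto_const L ratio close) simp_all
  have "((\<lambda>x. x * (\<Sum>a\<in>?R. a\<^sup>2 * w a / (x - a)))
     \<longlongrightarrow> (\<Sum>\<epsilon>\<in>signs n. ?c1 \<epsilon> j * 0) / 2 ^ n + ((\<Sum>\<epsilon>\<in>signs n. ?c2 \<epsilon> j * 1) / 2 ^ n + 0)) at_top"
  proof (rule Lim_transform_eventually[OF lim2])
    show "eventually (\<lambda>x. (\<Sum>\<epsilon>\<in>signs n. ?c1 \<epsilon> j * (x * (?p \<epsilon> x - ?q x) / ?q x)) / 2 ^ n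
        + ((\<Sum>\<epsilon>\<in>signs n. ?c2 \<epsilon> j * (?p \<epsilon> x / ?q x)) / 2 ^ n + poly (weighted_G A ?c3 j) x / ?q x)
       = x * (\<Sum>a\<in>?R. a\<^sup>2 * w a / (x - a))) at_top"
      using F2
    proof eventually_elim
      case (elim x)
      have "x * (\<Sum>a\<in>?R. a\<^sup>2 * w a / (x - a))
        = (\<Sum>\<epsilon>\<in>signs n. ?c1 \<epsilon> j * (x * (?p \<epsilon> x - ?q x) / ?q x)) / 2 ^ n + x * poly (weighted_G A ?c2 j) x / ?q x"
        unfolding elim distrib_left by (simp add: sum_distrib_left mult_ac)
      also have "x * poly (weighted_G A ?c2 j) x / ?q x
        = (\<Sum>\<epsilon>\<in>signs n. ?c2 \<epsilon> j * (?p \<epsilon> x / ?q x)) / 2 ^ n + poly (weighted_G A ?c3 j) x / ?q x"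
        unfolding step2 add_divide_distrib by (simp add: sum_divide_distrib mult.commute)
      finally show ?case ..
    qed
  qed
  then have "(\<Sum>a\<in>?R. a\<^sup>2 * w a) = ?m2"
    using tendsto_unique[OF _ partial_fractions_tendsto[of "\<lambda>a. a\<^sup>2 * w a"]] by fastforce
  then show ?H2 using average_cut_mat_square[OF A diag ij] by simp
qed

section \<open>From quadratic forms to the matrix-valued decomposition\<close>

lemma G_poly_symmetric:
  assumes A: "A \<in> carrier_mat n n" and sym: "transpose_mat A = A" and ij: "i < n" "j < n"
  shows "G_poly A i j = G_poly A j i"
proof -
  have A_sym: "A $$ (k, l) = A $$ (l, k)" if "k < n" "l < n" for k l
    using that A sym by (metis carrier_matD index_transpose_mat(1))
  have "adj_mat (char_poly_matrix (cut_mat A \<epsilon>)) $$ (i, j) = adj_mat (char_poly_matrix (cut_mat A \<epsilon>)) $$ (j, i)" for \<epsilon>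
  proof (rule adj_mat_symmetric[OF char_poly_matrix_closed[OF cut_mat_carrier[OF A]] _ ij])
    note C = char_poly_matrix_closed[OF cut_mat_carrier[OF A, of \<epsilon>]]
    show "transpose_mat (char_poly_matrix (cut_mat A \<epsilon>)) = char_poly_matrix (cut_mat A \<epsilon>)"
    proof (rule eq_matI)
      fix k l assume "k < dim_row (char_poly_matrix (cut_mat A \<epsilon>))" "l < dim_col (char_poly_matrix (cut_mat A \<epsilon>))"
      then have kl: "k < n" "l < n" using C by auto
      then show "transpose_mat (char_poly_matrix (cut_mat A \<epsilon>)) $$ (k, l) = char_poly_matrix (cut_mat A \<epsilon>) $$ (k, l)"
        using C by (simp add: char_poly_matrix_index[OF cut_mat_carrier[OF A]] cut_mat_index[OF A] A_sym mult.commute)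
    qed (use C in auto)
  qed
  then show ?thesis by (simp add: G_poly_def)
qed

lemma q_poly_nonzero: "A \<in> carrier_mat n n \<Longrightarrow> q_poly A \<noteq> 0"
  using q_poly_monic(2)[of A n] by auto

lemma finite_q_roots: "A \<in> carrier_mat n n \<Longrightarrow> finite (q_roots A)"
  unfolding q_roots_def by (intro poly_roots_finite q_poly_nonzero)

lemma rpoly_q_poly_root_real:
  fixes z :: complex
  assumes "A \<in> carrier_mat n n" "transpose_mat A = A" "rpoly (q_poly A) z = 0"
  shows "z \<in> \<real>"
  using q_plus_rank_one_nonzero[OF assms(1,2), of _ 0] assms(3) by (intro rpoly_root_real[of "q_poly A"]) auto

text \<open>The set of roots is symmetric about 0, so its maximum also bounds the negative roots.
  The hypothesis on \<open>a\<close> makes the set nonempty, so the unspecified value of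
  \<open>r_max\<close> for \<open>n = 0\<close> never enters.\<close>

lemma abs_le_r_max:
  assumes A: "A \<in> carrier_mat n n" and a: "a \<in> q_roots A"
  shows "\<bar>a\<bar> \<le> r_max A"
proof -
  have "- a \<in> q_roots A" using a by (simp add: q_roots_def poly_q_poly_uminus[OF A])
  then show ?thesis using a finite_q_roots[OF A] by (auto simp: r_max_def abs_le_iff)
qed

lemma rpoly_quadratic_form:
  "rpoly (\<Sum>i<n. \<Sum>j<n. Polynomial.smult (v i * v j) (G i j)) z
    = (\<Sum>i<n. \<Sum>j<n. of_real (v i * v j) * rpoly (G i j) z)"
proof -
  interpret comm_ring_hom "\<lambda>p. rpoly p z" by (rule comm_ring_hom_rpoly)
  show ?thesis by (simp add: hom_sum)
qed

lemma q_poly_dvd_quadratic_form: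
  assumes A: "A \<in> carrier_mat n n" and sym: "transpose_mat A = A"
  shows "q_poly A dvd (\<Prod>a\<in>q_roots A. [:- a, 1:]) * (\<Sum>i<n. \<Sum>j<n. Polynomial.smult (v i * v j) (G_poly A i j))"
  unfolding q_roots_def
proof (rule dvd_distinct_roots_mult)
  show "Im (rpoly (\<Sum>i<n. \<Sum>j<n. Polynomial.smult (v i * v j) (G_poly A i j)) z / rpoly (q_poly A) z) \<le> 0"
    if "0 < Im z" for z
    unfolding rpoly_quadratic_form by (rule Im_quotient_nonpos) (rule q_plus_rank_one_nonzero[OF A sym that])
qed (use q_poly_nonzero[OF A] rpoly_q_poly_root_real[OF A sym] in auto)

lemma sum_smult_indicator:
  fixes H :: "nat \<Rightarrow> nat \<Rightarrow> 'a::comm_ring_1 poly"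
  assumes "i < n" "j < n"
  shows "(\<Sum>k<n. \<Sum>l<n. Polynomial.smult ((if k = i then 1 else 0) * (if l = j then 1 else 0)) (H k l)) = H i j"
proof -
  have "(\<Sum>k<n. \<Sum>l<n. Polynomial.smult ((if k = i then 1 else 0) * (if l = j then 1 else 0)) (H k l))
    = (\<Sum>k<n. if k = i then (\<Sum>l<n. if l = j then H i j else 0) else 0)"
  proof (rule sum.cong[OF refl])
    fix k
    have "Polynomial.smult ((if k = i then 1 else 0) * (if l = j then 1 else 0)) (H k l)
      = (if k = i then if l = j then H i j else 0 else 0)" for l by simp
    then show "(\<Sum>l<n. Polynomial.smult ((if k = i then 1 else 0) * (if l = j then 1 else 0)) (H k l))
      = (if k = i then (\<Sum>l<n. if l = j then H i j else 0) else 0)" by simp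
  qed
  also have "\<dots> = H i j" using assms by simp
  finally show ?thesis .
qed

text \<open>Polarization: the unit vectors give the diagonal entries, and the sum of two of them
  gives \<open>G_poly A i i + 2 G_poly A i j + G_poly A j j\<close>, from which the diagonal terms
  are subtracted.\<close>

lemma q_poly_dvd_G_poly:
  assumes A: "A \<in> carrier_mat n n" and sym: "transpose_mat A = A" and ij: "i < n" "j < n"
  shows "q_poly A dvd (\<Prod>a\<in>q_roots A. [:- a, 1:]) * G_poly A i j"
proof -
  let ?r = "\<Prod>a\<in>q_roots A. [:- a, 1:]"
  let ?e = "\<lambda>i k. if k = i then 1 else 0 :: real"
  have diag: "q_poly A dvd ?r * G_poly A k k" if "k < n" for k
    using q_poly_dvd_quadratic_form[OF A sym, of "?e k"] sum_smult_indicator[OF that that, of "G_poly A"] by simp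
  have "(\<Sum>k<n. \<Sum>l<n. Polynomial.smult ((?e i k + ?e j k) * (?e i l + ?e j l)) (G_poly A k l))
    = G_poly A i i + G_poly A i j + G_poly A j i + G_poly A j j"
    unfolding distrib_left distrib_right smult_add_left sum.distrib
    by (simp only: sum_smult_indicator ij add_ac)
  also have "\<dots> = Polynomial.smult 2 (G_poly A i j) + (G_poly A i i + G_poly A j j)"
    using G_poly_symmetric[OF A sym ij] smult_add_left[of 1 1 "G_poly A i j"] by simp
  finally have "q_poly A dvd ?r * (Polynomial.smult 2 (G_poly A i j) + (G_poly A i i + G_poly A j j))"
    using q_poly_dvd_quadratic_form[OF A sym, of "\<lambda>k. ?e i k + ?e j k"] by simp
  then have "q_poly A dvd ?r * Polynomial.smult 2 (G_poly A i j)"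
    using diag[OF ij(1)] diag[OF ij(2)] by (simp add: distrib_left dvd_add_left_iff)
  then have "q_poly A dvd Polynomial.smult 2 (?r * G_poly A i j)" by simp
  then show ?thesis by (rule dvd_smult_cancel) simp
qed

lemma psd_mat_mat:
  assumes sym: "\<And>i j. i < n \<Longrightarrow> j < n \<Longrightarrow> f i j = f j i"
    and nonneg: "\<And>v. 0 \<le> (\<Sum>i<n. \<Sum>j<n. v i * v j * f i j)"
  shows "psd_mat (mat n n (\<lambda>(i, j). f i j))"
  unfolding psd_mat_def
proof (intro conjI ballI)
  show "transpose_mat (mat n n (\<lambda>(i, j). f i j)) = mat n n (\<lambda>(i, j). f i j)"
    by (rule eq_matI) (simp_all add: sym)
  fix v :: "real Matrix.vec" assume "v \<in> carrier_vec (dim_row (mat n n (\<lambda>(i, j). f i j)))"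
  then have "v \<bullet> (mat n n (\<lambda>(i, j). f i j) *\<^sub>v v) = (\<Sum>i<n. \<Sum>j<n. v $ i * v $ j * f i j)"
    by (simp add: scalar_prod_def atLeast0LessThan sum_distrib_left mult_ac)
  then show "0 \<le> v \<bullet> (mat n n (\<lambda>(i, j). f i j) *\<^sub>v v)" using nonneg[of "\<lambda>i. v $ i"] by simp
qed simp

lemma sum_quadratic_form_swap:
  fixes f :: "nat \<Rightarrow> nat \<Rightarrow> 'b \<Rightarrow> 'a::comm_ring_1"
  shows "(\<Sum>i\<in>I. \<Sum>j\<in>J. b i j * (\<Sum>a\<in>R. c a * f i j a)) = (\<Sum>a\<in>R. c a * (\<Sum>i\<in>I. \<Sum>j\<in>J. b i j * f i j a))"
proof -
  have "(\<Sum>i\<in>I. \<Sum>j\<in>J. b i j * (\<Sum>a\<in>R. c a * f i j a)) = (\<Sum>i\<in>I. \<Sum>j\<in>J. \<Sum>a\<in>R. c a * (b i j * f i j a))"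
    by (simp add: sum_distrib_left mult_ac)
  also have "\<dots> = (\<Sum>i\<in>I. \<Sum>a\<in>R. \<Sum>j\<in>J. c a * (b i j * f i j a))"
    by (rule sum.cong[OF refl], rule sum.swap)
  also have "\<dots> = (\<Sum>a\<in>R. \<Sum>i\<in>I. \<Sum>j\<in>J. c a * (b i j * f i j a))" by (rule sum.swap)
  finally show ?thesis by (simp only: sum_distrib_left)
qed

theorem corollary3p4:
  fixes A :: "real mat" and n :: nat
  assumes A: "A \<in> carrier_mat n n"
    and sym: "transpose_mat A = A"
    and zero_diag: "\<And>i. i < n \<Longrightarrow> A $$ (i, i) = 0"
  shows "(\<forall>z :: complex. poly (map_poly of_real (q_poly A)) z = 0 \<longrightarrow>
            z \<in> of_real ` {- r_max A .. r_max A}) \<and>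
    (\<exists>W :: real \<Rightarrow> real mat.
       (\<forall>l \<in> q_roots A. W l \<in> carrier_mat n n \<and> psd_mat (W l)) \<and>
       (\<forall>x. poly (q_poly A) x \<noteq> 0 \<longrightarrow>
          F_mat A x = mat_sum n (\<lambda>l. (1 / (x - l)) \<cdot>\<^sub>m W l) (q_roots A)) \<and>
       H_mat A W 0 = 1\<^sub>m n \<and>
       H_mat A W 1 = (1 / 2) \<cdot>\<^sub>m A \<and>
       H_mat A W 2 = (1 / 4) \<cdot>\<^sub>m (A * A + diag_part (A * A)) \<and>
       (\<forall>s \<ge> 1. H_mat A W (2 * s) \<preceq>\<^sub>L (r_max A)\<^sup>2 \<cdot>\<^sub>m H_mat A W (2 * s - 2))) \<and>
    A * A + diag_part (A * A) \<preceq>\<^sub>L (4 * (r_max A)\<^sup>2) \<cdot>\<^sub>m 1\<^sub>m n"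
proof -
  let ?R = "q_roots A"
  note fin = finite_q_roots[OF A]
  have dimA: "dim_row A = n" using A by simp
  \<comment> \<open>The weights are chosen per polynomial rather than per index pair, so that the
    symmetry of \<open>G_poly\<close> makes the weight matrices symmetric at once.\<close>
  let ?G = "(\<lambda>(i, j). G_poly A i j) ` ({..<n} \<times> {..<n})"
  have "\<exists>w. \<forall>z::complex. rpoly (q_poly A) z \<noteq> 0 \<longrightarrow>
      rpoly g z / rpoly (q_poly A) z = (\<Sum>a\<in>?R. of_real (w a) / (z - of_real a))"
    if g_mem: "g \<in> ?G" for g
  proof -
    obtain i j where ij: "i < n" "j < n" and g: "g = G_poly A i j" using g_mem by auto
    have "degree g < degree (q_poly A)"
      unfolding g G_poly_eq_weighted_G[OF A ij] by (simp add: degree_weighted_G[OF A ij(2)] q_poly_monic[OF A])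
    then show ?thesis
      using q_poly_dvd_G_poly[OF A sym ij] unfolding g q_roots_def by (intro partial_fractions_simple_poles)
  qed
  then have "\<forall>g\<in>?G. \<exists>w. \<forall>z::complex. rpoly (q_poly A) z \<noteq> 0 \<longrightarrow>
      rpoly g z / rpoly (q_poly A) z = (\<Sum>a\<in>?R. of_real (w a) / (z - of_real a))"
    by (rule ballI)
  from bchoice[OF this] obtain W where W: "\<forall>g\<in>?G. \<forall>z::complex. rpoly (q_poly A) z \<noteq> 0 \<longrightarrow>
      rpoly g z / rpoly (q_poly A) z = (\<Sum>a\<in>?R. of_real (W g a) / (z - of_real a))" ..
  define w where "w i j a = W (G_poly A i j) a" for i j a
  have pf: "rpoly (G_poly A i j) z / rpoly (q_poly A) z = (\<Sum>a\<in>?R. of_real (w i j a) / (z - of_real a))"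
    if "i < n" "j < n" "rpoly (q_poly A) z \<noteq> 0" for i j and z :: complex
    unfolding w_def using that by (intro W[rule_format]) auto
  have w_sym: "w i j = w j i" if "i < n" "j < n" for i j
    unfolding w_def G_poly_symmetric[OF A sym that] ..
  \<comment> \<open>The residue of \<open>v\<^sup>T F v\<close> at \<open>a\<close> is the quadratic
    form of the weight matrix at \<open>v\<close>, and the imaginary part of this function is
    nonpositive in the upper half plane.\<close>
  have w_pos: "0 \<le> (\<Sum>i<n. \<Sum>j<n. v i * v j * w i j a)" if "a \<in> ?R" for v a
  proof (rule residue_nonneg[OF fin that])
    fix z :: complex assume z: "0 < Im z"
    have q: "rpoly (q_poly A) z \<noteq> 0" using q_plus_rank_one_nonzero[OF A sym z, of 0] by simp
    have "(\<Sum>b\<in>?R. of_real (\<Sum>i<n. \<Sum>j<n. v i * v j * w i j b) / (z - of_real b))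
      = (\<Sum>b\<in>?R. inverse (z - of_real b) * (\<Sum>i<n. \<Sum>j<n. of_real (v i * v j) * of_real (w i j b)))"
      by (simp add: divide_inverse mult.commute)
    also have "\<dots> = (\<Sum>i<n. \<Sum>j<n. of_real (v i * v j) * (\<Sum>b\<in>?R. inverse (z - of_real b) * of_real (w i j b)))"
      by (rule sum_quadratic_form_swap[symmetric])
    also have "\<dots> = (\<Sum>i<n. \<Sum>j<n. of_real (v i * v j) * (rpoly (G_poly A i j) z / rpoly (q_poly A) z))"
      using q by (intro sum.cong refl arg_cong[of _ _ "(*) _"], subst pf) (simp_all add: divide_inverse mult.commute)
    also have "\<dots> = (\<Sum>i<n. \<Sum>j<n. of_real (v i * v j) * rpoly (G_poly A i j) z) / rpoly (q_poly A) z"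
      by (simp add: sum_divide_distrib)
    finally show "Im (\<Sum>b\<in>?R. of_real (\<Sum>i<n. \<Sum>j<n. v i * v j * w i j b) / (z - of_real b)) \<le> 0"
      using Im_quotient_nonpos[OF q_plus_rank_one_nonzero[OF A sym z]] by simp
  qed
  have pf_real: "poly (G_poly A i j) x / poly (q_poly A) x = (\<Sum>a\<in>?R. w i j a / (x - a))"
    if "i < n" "j < n" "poly (q_poly A) x \<noteq> 0" for i j x
  proof -
    have "complex_of_real (poly (G_poly A i j) x / poly (q_poly A) x) = of_real (\<Sum>a\<in>?R. w i j a / (x - a))"
      using pf[OF that(1,2), of "of_real x"] that(3) by (simp add: rpoly_of_real)
    then show ?thesis by (simp only: of_real_eq_iff)
  qed
  define V where "V a = mat n n (\<lambda>(i, j). w i j a)" for a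
  have H: "H_mat A V m = mat n n (\<lambda>(i, j). \<Sum>a\<in>?R. a ^ m * w i j a)" for m
    unfolding H_mat_def mat_sum_def dimA by (rule eq_matI) (simp_all add: V_def)
  have moments: "(\<Sum>a\<in>?R. w i j a) = (if i = j then 1 else 0)"
    "(\<Sum>a\<in>?R. a * w i j a) = A $$ (i, j) / 2"
    "(\<Sum>a\<in>?R. a\<^sup>2 * w i j a) = (A * A + diag_part (A * A)) $$ (i, j) / 4" if "i < n" "j < n" for i j
    using moments_of_partial_fractions[OF A zero_diag that pf_real[OF that]] by auto
  \<comment> \<open>Both Loewner inequalities are instances of this; only the nonnegative
    coefficients \<open>c\<close> differ.\<close>
  have psd: "psd_mat (mat n n (\<lambda>(i, j). \<Sum>a\<in>?R. c a * w i j a))" if "\<And>a. a \<in> ?R \<Longrightarrow> 0 \<le> c a" for c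
  proof (rule psd_mat_mat)
    show "0 \<le> (\<Sum>i<n. \<Sum>j<n. v i * v j * (\<Sum>a\<in>?R. c a * w i j a))" for v
      unfolding sum_quadratic_form_swap by (rule sum_nonneg) (rule mult_nonneg_nonneg[OF that w_pos])
  qed (simp add: w_sym)
  have sq: "a\<^sup>2 \<le> (r_max A)\<^sup>2" if "a \<in> ?R" for a
    using abs_le_r_max[OF A that] by (simp add: abs_le_square_iff[symmetric])
  have dims: "A * A + diag_part (A * A) \<in> carrier_mat n n"
    using A by (simp add: diag_part_def mat_diag_def)
  have 1: "\<forall>z::complex. rpoly (q_poly A) z = 0 \<longrightarrow> z \<in> of_real ` {- r_max A .. r_max A}"
  proof (intro allI impI)
    fix z :: complex assume z: "rpoly (q_poly A) z = 0"
    then obtain x where x: "z = of_real x" using rpoly_q_poly_root_real[OF A sym] by (auto elim: Reals_cases)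
    then have "x \<in> ?R" using z by (simp add: q_roots_def rpoly_of_real)
    then show "z \<in> of_real ` {- r_max A .. r_max A}"
      using abs_le_r_max[OF A] unfolding x by (intro imageI) (simp add: abs_le_iff minus_le_iff)
  qed
  have V: "V l \<in> carrier_mat n n" for l by (simp add: V_def)
  have 2: "psd_mat (V l)" if "l \<in> ?R" for l
    using psd_mat_mat[of n "\<lambda>i j. w i j l"] w_sym w_pos[OF that] by (simp add: V_def)
  have 3: "F_mat A x = mat_sum n (\<lambda>l. (1 / (x - l)) \<cdot>\<^sub>m V l) ?R" if "poly (q_poly A) x \<noteq> 0" for x
  proof (rule eq_matI)
    fix i j assume "i < dim_row (mat_sum n (\<lambda>l. (1 / (x - l)) \<cdot>\<^sub>m V l) ?R)" "j < dim_col (mat_sum n (\<lambda>l. (1 / (x - l)) \<cdot>\<^sub>m V l) ?R)"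
    then have ij: "i < n" "j < n" by (simp_all add: mat_sum_def)
    have "G_mat A x \<in> carrier_mat n n" by (simp add: G_mat_def dimA)
    then have "F_mat A x $$ (i, j) = poly (G_poly A i j) x / poly (q_poly A) x"
      using ij by (simp add: F_mat_def G_mat_index[OF A ij])
    then show "F_mat A x $$ (i, j) = mat_sum n (\<lambda>l. (1 / (x - l)) \<cdot>\<^sub>m V l) ?R $$ (i, j)"
      using ij by (simp add: pf_real that mat_sum_def V_def)
  qed (simp_all add: F_mat_def G_mat_def mat_sum_def dimA)
  have H0: "H_mat A V 0 = 1\<^sub>m n"
    unfolding H by (rule eq_matI) (simp_all add: moments)
  have H1: "H_mat A V 1 = (1 / 2) \<cdot>\<^sub>m A"
    unfolding H by (rule eq_matI) (use A in \<open>simp_all add: moments\<close>)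
  have H2: "H_mat A V 2 = (1 / 4) \<cdot>\<^sub>m (A * A + diag_part (A * A))"
    unfolding H by (rule eq_matI) (use dims in \<open>simp_all add: moments del: index_add_mat index_mult_mat\<close>)
  have H_le: "H_mat A V (2 * s) \<preceq>\<^sub>L (r_max A)\<^sup>2 \<cdot>\<^sub>m H_mat A V (2 * s - 2)" if "1 \<le> s" for s
  proof -
    \<comment> \<open>The hypothesis \<open>1 \<le> s\<close> keeps the natural subtraction in
      \<open>2 * s - 2\<close> from truncating.\<close>
    have "a ^ (2 * s) = a\<^sup>2 * a ^ (2 * s - 2)" for a :: real
      using that unfolding power_add[symmetric] by (intro arg_cong[of _ _ "(^) a"]) simp
    then have "(r_max A)\<^sup>2 \<cdot>\<^sub>m H_mat A V (2 * s - 2) - H_mat A V (2 * s)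
      = mat n n (\<lambda>(i, j). \<Sum>a\<in>?R. (((r_max A)\<^sup>2 - a\<^sup>2) * a ^ (2 * s - 2)) * w i j a)"
      unfolding H by (intro eq_matI) (simp_all add: sum_distrib_left sum_subtractf algebra_simps)
    moreover have "psd_mat \<dots>"
    proof (rule psd)
      have "even (2 * s - 2)" by simp
      then show "0 \<le> ((r_max A)\<^sup>2 - a\<^sup>2) * a ^ (2 * s - 2)" if "a \<in> ?R" for a
        using sq[OF that] by (simp add: zero_le_even_power)
    qed
    ultimately show ?thesis unfolding loewner_le_def by (simp add: H)
  qed
  have 4: "A * A + diag_part (A * A) \<preceq>\<^sub>L (4 * (r_max A)\<^sup>2) \<cdot>\<^sub>m 1\<^sub>m n"
  proof -
    have entry: "(c \<cdot>\<^sub>m 1\<^sub>m n - B) $$ (i, j) = c * (if i = j then 1 else 0) - B $$ (i, j)"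
      if "B \<in> carrier_mat n n" "i < n" "j < n" for c :: real and B i j
      using that by simp
    \<comment> \<open>The zeroth moment expands the identity matrix and four times the second moment
      expands \<open>A * A + diag_part (A * A)\<close>, whence the coefficients
      \<open>4 * ((r_max A)\<^sup>2 - a\<^sup>2)\<close>.\<close>
    have "(4 * (r_max A)\<^sup>2) \<cdot>\<^sub>m 1\<^sub>m n - (A * A + diag_part (A * A))
      = mat n n (\<lambda>(i, j). \<Sum>a\<in>?R. (4 * ((r_max A)\<^sup>2 - a\<^sup>2)) * w i j a)"
    proof (rule eq_matI)
      fix i j assume "i < dim_row (mat n n (\<lambda>(i, j). \<Sum>a\<in>?R. (4 * ((r_max A)\<^sup>2 - a\<^sup>2)) * w i j a))"
        "j < dim_col (mat n n (\<lambda>(i, j). \<Sum>a\<in>?R. (4 * ((r_max A)\<^sup>2 - a\<^sup>2)) * w i j a))"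
      then have ij: "i < n" "j < n" by simp_all
      have "(\<Sum>a\<in>?R. (4 * ((r_max A)\<^sup>2 - a\<^sup>2)) * w i j a)
        = (\<Sum>a\<in>?R. 4 * (r_max A)\<^sup>2 * w i j a - 4 * (a\<^sup>2 * w i j a))"
        by (simp add: algebra_simps)
      also have "\<dots> = 4 * (r_max A)\<^sup>2 * (\<Sum>a\<in>?R. w i j a) - 4 * (\<Sum>a\<in>?R. a\<^sup>2 * w i j a)"
        by (simp only: sum_distrib_left sum_subtractf)
      also have "\<dots> = 4 * (r_max A)\<^sup>2 * (if i = j then 1 else 0) - (A * A + diag_part (A * A)) $$ (i, j)"
        unfolding moments[OF ij] by simp
      finally show "((4 * (r_max A)\<^sup>2) \<cdot>\<^sub>m 1\<^sub>m n - (A * A + diag_part (A * A))) $$ (i, j)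
        = mat n n (\<lambda>(i, j). \<Sum>a\<in>?R. (4 * ((r_max A)\<^sup>2 - a\<^sup>2)) * w i j a) $$ (i, j)"
        unfolding entry[OF dims ij] using ij by (simp only: index_mat prod.case)
    qed (use dims in auto)
    moreover have "psd_mat \<dots>" by (rule psd) (simp add: sq)
    ultimately show ?thesis unfolding loewner_le_def using dims by auto
  qed
  show ?thesis
    by (rule conjI[OF 1 conjI[OF exI[of _ V] 4]])
      (intro conjI ballI allI impI V 2 3 H0 H1 H2 H_le; assumption)
qed

end
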